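(* Let $G=(V,E,L)$ be a weakly $6$-balanced looped simple graph and let $F\subseteq E\cup L$ with $|F|\leq 3$. Then $G-F$ is $\mathcal{L}_2$-rigid (i.e. $2$-rigid as a linearly constrained framework).
   Context: A looped simple graph $G=(V,E,L)$ has vertex set $V$, a set $E$ of simple edges (no multiple edges) and a set $L$ of loops (a vertex may carry several loops). For $T\subseteq V$, $G-T$ deletes the vertices of $T$ with all incident edges and loops; $G-F$ deletes the members of $F\subseteq E\cup L$. $G$ is weakly $k$-balanced if for every $T\subseteq V$ with $|T|\leq k$, every connected component of $G-T$ contains at least $k-|T|$ loops. A linearly constrained framework $(G,p,q)$ in $\mathbb{R}^d$ consists of $G$, $p:V\to\mathbb{R}^d$, $q:L\to\mathbb{R}^d$. Its rigidity matrix $R_d(G,p,q)$ is the $(|E|+|L|)\times d|V|$ matrix whose row for an edge $v_iv_j$ has $p(v_i)-p(v_j)$ in the columns of $v_i$, $p(v_j)-p(v_i)$ in the columns of $v_j$, zeros elsewhere, and whose row for a loop $e$ at $v_i$ has $q(e)$ in the columns of $v_i$, zeros elsewhere. $(p,q)$ is generic if all its coordinates are algebraically independent over $\mathbb{Q}$. The matroid $\mathcal{R}^{lc}_d(G)$ on $E\cup L$ has as independent sets those sets whose rows in $R_d(G,p,q)$ are linearly independent for generic $(p,q)$; $r^{lc}_d$ is its rank function. $G$ is $\mathcal{L}_d$-rigid if $r^{lc}_d(E\cup L)=d|V|$. *)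

theory Defs
  imports "HOL-Analysis.Finite_Cartesian_Product" "HOL-Library.Numeral_Type"
    "HOL-Library.Poly_Mapping"
begin

section \<open>Looped simple graphs\<close>

text \<open>Edges are two-element sets of vertices. Loops are named objects, so that a vertex
  may carry several of them; \<open>loop_vertex\<close> gives the vertex at which a loop sits.\<close>

record ('v, 'l) lgraph =
  verts :: "'v set"
  edges :: "'v set set"
  loops :: "'l set"
  loop_vertex :: "'l \<Rightarrow> 'v"

locale looped_simple_graph =
  fixes G :: "('v, 'l) lgraph" (structure)
  assumes finite_verts: "finite (verts G)"
    and finite_loops: "finite (loops G)"
    and edges_simple: "e \<in> edges G \<Longrightarrow> e \<subseteq> verts G \<and> card e = 2"
    and loop_vertex_in_verts: "l \<in> loops G \<Longrightarrow> loop_vertex G l \<in> verts G"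

text \<open>The disjoint union \<open>E \<union> L\<close>.\<close>

definition elements :: "('v, 'l) lgraph \<Rightarrow> ('v set + 'l) set" where
  "elements G = edges G <+> loops G"

definition delete_verts :: "('v, 'l) lgraph \<Rightarrow> 'v set \<Rightarrow> ('v, 'l) lgraph" where
  "delete_verts G T = G\<lparr>verts := verts G - T,
     edges := {e \<in> edges G. e \<inter> T = {}},
     loops := {l \<in> loops G. loop_vertex G l \<notin> T}\<rparr>"

definition delete_elements :: "('v, 'l) lgraph \<Rightarrow> ('v set + 'l) set \<Rightarrow> ('v, 'l) lgraph" where
  "delete_elements G F = G\<lparr>edges := {e \<in> edges G. Inl e \<notin> F},
     loops := {l \<in> loops G. Inr l \<notin> F}\<rparr>"

definition connected_rel :: "('v, 'l) lgraph \<Rightarrow> ('v \<times> 'v) set" where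
  "connected_rel G = {(u, v). u \<in> verts G \<and> v \<in> verts G \<and>
     (u, v) \<in> {(x, y). {x, y} \<in> edges G}\<^sup>*}"

text \<open>Connected components are represented by their vertex sets.\<close>

definition components :: "('v, 'l) lgraph \<Rightarrow> 'v set set" where
  "components G = verts G // connected_rel G"

definition weakly_balanced :: "nat \<Rightarrow> ('v, 'l) lgraph \<Rightarrow> bool" where
  "weakly_balanced k G \<longleftrightarrow>
     (\<forall>T \<subseteq> verts G. card T \<le> k \<longrightarrow>
       (\<forall>C \<in> components (delete_verts G T).
          k - card T \<le> card {l \<in> loops (delete_verts G T). loop_vertex G l \<in> C}))"


section \<open>Algebraic independence over the rationals\<close>

text \<open>A polynomial with rational coefficients in variables indexed by \<open>'i\<close> is a finitely
  supported map from monomials (finitely supported exponent maps) to coefficients.\<close>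

definition poly_vars :: "(('i \<Rightarrow>\<^sub>0 nat) \<Rightarrow>\<^sub>0 rat) \<Rightarrow> 'i set" where
  "poly_vars P = (\<Union>m \<in> Poly_Mapping.keys P. Poly_Mapping.keys m)"

definition poly_eval :: "(('i \<Rightarrow>\<^sub>0 nat) \<Rightarrow>\<^sub>0 rat) \<Rightarrow> ('i \<Rightarrow> real) \<Rightarrow> real" where
  "poly_eval P c = (\<Sum>m \<in> Poly_Mapping.keys P. of_rat (Poly_Mapping.lookup P m) *
     (\<Prod>i \<in> Poly_Mapping.keys m. c i ^ Poly_Mapping.lookup m i))"

definition alg_independent_rat :: "('i \<Rightarrow> real) \<Rightarrow> 'i set \<Rightarrow> bool" where
  "alg_independent_rat c I \<longleftrightarrow> (\<forall>P. poly_vars P \<subseteq> I \<and> poly_eval P c = 0 \<longrightarrow> P = 0)"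


section \<open>Linearly constrained frameworks\<close>

definition generic :: "('v, 'l) lgraph \<Rightarrow> ('v \<Rightarrow> real^'d) \<Rightarrow> ('l \<Rightarrow> real^'d) \<Rightarrow> bool" where
  "generic G p q \<longleftrightarrow>
     alg_independent_rat (\<lambda>(x, i). case_sum p q x $ i) ((verts G <+> loops G) \<times> UNIV)"

text \<open>The entry of \<open>R\<^sub>d(G,p,q)\<close> in a given row (an edge or a loop) and column (a vertex and
  a coordinate). For an edge \<open>e\<close> and \<open>v \<in> e\<close> the sum has the other end of \<open>e\<close>
  as its only index, see \<open>rigidity_matrix_edge\<close>.\<close>

fun rigidity_matrix ::
  "('v, 'l) lgraph \<Rightarrow> ('v \<Rightarrow> real^'d) \<Rightarrow> ('l \<Rightarrow> real^'d) \<Rightarrow> 'v set + 'l \<Rightarrow> 'v \<times> 'd \<Rightarrow> real" where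
  "rigidity_matrix G p q (Inl e) (v, i) = (if v \<in> e then (\<Sum>u \<in> e - {v}. p v - p u) $ i else 0)"
| "rigidity_matrix G p q (Inr l) (v, i) = (if v = loop_vertex G l then q l $ i else 0)"

lemma rigidity_matrix_edge:
  assumes "u \<noteq> v"
  shows "rigidity_matrix G p q (Inl {u, v}) (w, i) =
    (if w = u then (p u - p v) $ i else if w = v then (p v - p u) $ i else 0)"
proof -
  have "{u, v} - {u} = {v}" "{u, v} - {v} = {u}" using assms by auto
  then show ?thesis by auto
qed

text \<open>Linear independence of the rows of a matrix \<open>M\<close> with column set \<open>C\<close> that are indexed
  by \<open>X\<close>, as a family: equal rows with different indices are dependent.\<close>

definition rows_independent :: "('r \<Rightarrow> 'c \<Rightarrow> real) \<Rightarrow> 'c set \<Rightarrow> 'r set \<Rightarrow> bool" where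
  "rows_independent M C X \<longleftrightarrow>
     (\<forall>a. (\<forall>c \<in> C. (\<Sum>x \<in> X. a x * M x c) = 0) \<longrightarrow> (\<forall>x \<in> X. a x = 0))"

text \<open>The independent sets and the rank function of the matroid \<open>\<R>\<^sup>l\<^sup>c\<^sub>d(G)\<close>. The dimension \<open>d\<close> is
  the cardinality of the type argument.\<close>

definition lc_independent ::
  "'d::finite itself \<Rightarrow> ('v, 'l) lgraph \<Rightarrow> ('v set + 'l) set \<Rightarrow> bool" where
  "lc_independent _ G X \<longleftrightarrow> X \<subseteq> elements G \<and>
     (\<forall>(p :: 'v \<Rightarrow> real^'d) (q :: 'l \<Rightarrow> real^'d). generic G p q \<longrightarrow>
        rows_independent (rigidity_matrix G p q) (verts G \<times> UNIV) X)"

definition lc_rank :: "'d::finite itself \<Rightarrow> ('v, 'l) lgraph \<Rightarrow> ('v set + 'l) set \<Rightarrow> nat" where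
  "lc_rank d G X = Max (card ` {Y. Y \<subseteq> X \<and> lc_independent d G Y})"

definition lc_rigid :: "'d::finite itself \<Rightarrow> ('v, 'l) lgraph \<Rightarrow> bool" where
  "lc_rigid d G \<longleftrightarrow> lc_rank d G (elements G) = CARD('d) * card (verts G)"

end

theory Submission
  imports Defs "HOL-Analysis.Continuum_Not_Denumerable"
begin

text \<open>Call a set of edges and loops sparse if every vertex set \<open>X\<close> spans at most \<open>2|X|\<close> of its
  elements, and at most \<open>2|X| - 3\<close> of its edges when \<open>|X| \<ge> 2\<close>. Sparse sets are independent at generic
  \<open>(p, q)\<close> (Streinu and Theran): remove a vertex of degree at most 3, replacing a vertex of degree 3
  by an edge between two neighbours or by a loop at a neighbour, and undo this step by placing the
  vertex at a special position; a dependence at generic positions would be a dependence everywhere.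

  In a maximal sparse subset of \<open>G - F\<close>, let \<open>Y\<close> be the largest vertex set with \<open>2|Y|\<close> elements and
  let \<open>\<X>\<close> be the maximal sets \<open>X\<close> with \<open>2|X| - 3\<close> edges that are not inside \<open>Y\<close>. The number of elements
  is \<open>2|Y| + (\<Sum>X\<in>\<X>. 2|X| - 3)\<close> plus the number of loops outside \<open>Y\<close>. The edges of \<open>F\<close>, added to \<open>\<X>\<close>
  as sets of size 2, complete it to a cover of all edges of \<open>G\<close> not inside \<open>Y\<close>, and a discharging
  argument in the style of Lovasz and Yemini shows that for a weakly 6-balanced graph such a cover,
  together with the loops outside \<open>Y\<close>, weighs at least \<open>2|V - Y| + 3\<close> unless \<open>Y = V\<close>.\<close>

section \<open>Generic points\<close>

text \<open>The 3 gained by the cover is what \<open>F\<close> may cost: an edge of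
  \<open>F\<close>, as a set of size 2, weighs 2 * 2 - 3 = 1, and a loop weighs 1 as well.

  The cover bound is proved in doubled form. For a set \<open>X\<close> of the cover let x and y
  count its vertices outside and inside \<open>Y\<close>, and let m be the number of loops outside
  \<open>Y\<close>. Discharging gives 4 |V - Y| \<le> \<Sum>(4x + 3y - 6) + m, whose right side is
  twice the weight of the sets, minus \<Sum>y, plus m. Balance at the cut around \<open>Y\<close>
  gives 6 \<le> \<Sum>y + m, and the two add up to the doubled bound. The number 6 enters in three
  ways: at this cut, at each single vertex, and at the bad vertices of a set.

  A vertex of degree 3 can always be reduced because only tight sets stand in the way. If all
  candidate replacements were blocked, the blocking sets would merge into one tight set containing
  every neighbour of the vertex; adding the vertex would then bring 3 elements while the bound grows
  by only 2.\<close>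

definition monom_eval :: "('i \<Rightarrow>\<^sub>0 nat) \<Rightarrow> ('i \<Rightarrow> real) \<Rightarrow> real" where
  "monom_eval m c = (\<Prod>i \<in> Poly_Mapping.keys m. c i ^ Poly_Mapping.lookup m i)"

lemma monom_eval_superset:
  assumes "finite A" "Poly_Mapping.keys m \<subseteq> A"
  shows "monom_eval m c = (\<Prod>i \<in> A. c i ^ Poly_Mapping.lookup m i)"
  unfolding monom_eval_def using assms
  by (intro prod.mono_neutral_left) (auto simp: in_keys_iff)

lemma monom_eval_add: "monom_eval (m + n) c = monom_eval m c * monom_eval n c"
proof -
  let ?A = "Poly_Mapping.keys m \<union> Poly_Mapping.keys n"
  have "monom_eval (m + n) c = (\<Prod>i \<in> ?A. c i ^ Poly_Mapping.lookup (m + n) i)"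
    using Poly_Mapping.keys_add[of m n] by (intro monom_eval_superset) auto
  also have "\<dots> = monom_eval m c * monom_eval n c"
    by (simp add: lookup_add power_add prod.distrib
        monom_eval_superset[of ?A m] monom_eval_superset[of ?A n])
  finally show ?thesis .
qed

lemma poly_eval_superset:
  assumes "finite A" "Poly_Mapping.keys P \<subseteq> A"
  shows "poly_eval P c = (\<Sum>m \<in> A. of_rat (Poly_Mapping.lookup P m) * monom_eval m c)"
  unfolding poly_eval_def monom_eval_def using assms
  by (intro sum.mono_neutral_left) (auto simp: in_keys_iff)

lemma poly_eval_zero [simp]: "poly_eval 0 c = 0"
  by (simp add: poly_eval_def)

lemma poly_eval_single: "poly_eval (Poly_Mapping.single m a) c = of_rat a * monom_eval m c"
  by (subst poly_eval_superset[of "{m}"]) auto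

lemma poly_eval_add: "poly_eval (P + Q) c = poly_eval P c + poly_eval Q c"
proof -
  let ?A = "Poly_Mapping.keys P \<union> Poly_Mapping.keys Q"
  have "poly_eval (P + Q) c = (\<Sum>m \<in> ?A. of_rat (Poly_Mapping.lookup (P + Q) m) * monom_eval m c)"
    using Poly_Mapping.keys_add[of P Q] by (intro poly_eval_superset) auto
  also have "\<dots> = poly_eval P c + poly_eval Q c"
    by (simp add: lookup_add of_rat_add algebra_simps sum.distrib
        poly_eval_superset[of ?A P] poly_eval_superset[of ?A Q])
  finally show ?thesis .
qed

lemma poly_eval_sum: "poly_eval (sum P A) c = (\<Sum>x\<in>A. poly_eval (P x) c)"
  by (induction A rule: infinite_finite_induct) (auto simp: poly_eval_add)

lemma poly_mapping_sum_single:
  "P = (\<Sum>m \<in> Poly_Mapping.keys P. Poly_Mapping.single m (Poly_Mapping.lookup P m))"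
  by (rule poly_mapping_eqI) (auto simp: lookup_sum lookup_single when_def in_keys_iff)

lemma poly_eval_mult: "poly_eval (P * Q) c = poly_eval P c * poly_eval Q c"
proof -
  have "P * Q = (\<Sum>m \<in> Poly_Mapping.keys P. Poly_Mapping.single m (Poly_Mapping.lookup P m)) *
      (\<Sum>n \<in> Poly_Mapping.keys Q. Poly_Mapping.single n (Poly_Mapping.lookup Q n))"
    using poly_mapping_sum_single[of P] poly_mapping_sum_single[of Q] by metis
  also have "poly_eval \<dots> c = poly_eval P c * poly_eval Q c"
    by (simp add: sum_product mult_single poly_eval_sum poly_eval_single monom_eval_add
        of_rat_mult poly_eval_superset[of "Poly_Mapping.keys P" P]
        poly_eval_superset[of "Poly_Mapping.keys Q" Q] algebra_simps)
  finally show ?thesis .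
qed

text \<open>Closure under the ring operations lets a function be recognised as a rational polynomial
  without writing down its coefficients.\<close>

definition rat_poly_fun :: "'i set \<Rightarrow> (('i \<Rightarrow> real) \<Rightarrow> real) \<Rightarrow> bool" where
  "rat_poly_fun I f \<longleftrightarrow> (\<exists>P. poly_vars P \<subseteq> I \<and> (\<forall>c. f c = poly_eval P c))"

lemma rat_poly_fun_var:
  assumes "i \<in> I" shows "rat_poly_fun I (\<lambda>c. c i)"
  unfolding rat_poly_fun_def
  by (rule exI[of _ "Poly_Mapping.single (Poly_Mapping.single i 1) 1"])
     (use assms in \<open>auto simp: poly_vars_def poly_eval_single monom_eval_def\<close>)

lemma rat_poly_fun_of_rat: "rat_poly_fun I (\<lambda>c. of_rat a)"
  unfolding rat_poly_fun_def
  by (rule exI[of _ "Poly_Mapping.single 0 a"])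
     (auto simp: poly_vars_def poly_eval_single monom_eval_def)

lemma rat_poly_fun_0: "rat_poly_fun I (\<lambda>c. 0)"
  using rat_poly_fun_of_rat[of I 0] by simp

lemma rat_poly_fun_add:
  assumes "rat_poly_fun I f" "rat_poly_fun I g"
  shows "rat_poly_fun I (\<lambda>c. f c + g c)"
proof -
  obtain P Q where "poly_vars P \<subseteq> I" "\<And>c. f c = poly_eval P c"
    "poly_vars Q \<subseteq> I" "\<And>c. g c = poly_eval Q c"
    using assms unfolding rat_poly_fun_def by blast
  moreover have "poly_vars (P + Q) \<subseteq> poly_vars P \<union> poly_vars Q"
    using Poly_Mapping.keys_add[of P Q] unfolding poly_vars_def by blast
  ultimately show ?thesis
    unfolding rat_poly_fun_def by (intro exI[of _ "P + Q"]) (auto simp: poly_eval_add)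
qed

lemma rat_poly_fun_mult:
  assumes "rat_poly_fun I f" "rat_poly_fun I g"
  shows "rat_poly_fun I (\<lambda>c. f c * g c)"
proof -
  obtain P Q where "poly_vars P \<subseteq> I" "\<And>c. f c = poly_eval P c"
    "poly_vars Q \<subseteq> I" "\<And>c. g c = poly_eval Q c"
    using assms unfolding rat_poly_fun_def by blast
  moreover have "poly_vars (P * Q) \<subseteq> poly_vars P \<union> poly_vars Q"
    using Poly_Mapping.keys_mult[of P Q] Poly_Mapping.keys_add unfolding poly_vars_def by fastforce
  ultimately show ?thesis
    unfolding rat_poly_fun_def by (intro exI[of _ "P * Q"]) (auto simp: poly_eval_mult)
qed

lemma rat_poly_fun_diff:
  assumes "rat_poly_fun I f" "rat_poly_fun I g"
  shows "rat_poly_fun I (\<lambda>c. f c - g c)"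
  using rat_poly_fun_add[OF assms(1) rat_poly_fun_mult[OF rat_poly_fun_of_rat[of _ "-1"] assms(2)]]
  by (simp add: of_rat_minus)

lemma rat_poly_fun_sum:
  assumes "\<And>x. x \<in> A \<Longrightarrow> rat_poly_fun I (f x)"
  shows "rat_poly_fun I (\<lambda>c. \<Sum>x\<in>A. f x c)"
  using assms by (induction A rule: infinite_finite_induct)
    (auto intro: rat_poly_fun_0 rat_poly_fun_add)

text \<open>The polynomial behind \<open>f\<close> must be zero, so \<open>f\<close> vanishes
  everywhere. The contrapositive is what gets used: one special point with a nonzero value decides
  the matter at every generic point.\<close>

lemma alg_independent_rat_poly_fun:
  assumes "alg_independent_rat c I" "rat_poly_fun I f" "f c = 0"
  shows "f c' = 0"
  using assms unfolding alg_independent_rat_def rat_poly_fun_def by fastforce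

section \<open>Existence of algebraically independent points\<close>

lemma countable_monomials:
  assumes "finite I"
  shows "countable {m :: 'i \<Rightarrow>\<^sub>0 nat. Poly_Mapping.keys m \<subseteq> I}"
proof -
  have "inj_on (\<lambda>m. restrict (Poly_Mapping.lookup m) I) {m :: 'i \<Rightarrow>\<^sub>0 nat. Poly_Mapping.keys m \<subseteq> I}"
  proof (rule inj_onI, rule poly_mapping_eqI)
    fix m n :: "'i \<Rightarrow>\<^sub>0 nat" and i
    assume "m \<in> {m. Poly_Mapping.keys m \<subseteq> I}" "n \<in> {m. Poly_Mapping.keys m \<subseteq> I}"
      and eq: "restrict (Poly_Mapping.lookup m) I = restrict (Poly_Mapping.lookup n) I"
    then have "i \<notin> I \<Longrightarrow> Poly_Mapping.lookup m i = 0 \<and> Poly_Mapping.lookup n i = 0"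
      by (auto simp: in_keys_iff)
    then show "Poly_Mapping.lookup m i = Poly_Mapping.lookup n i"
      using fun_cong[OF eq, of i] by (cases "i \<in> I") auto
  qed
  moreover have "countable ((\<lambda>m. restrict (Poly_Mapping.lookup m) I) ` {m :: 'i \<Rightarrow>\<^sub>0 nat. Poly_Mapping.keys m \<subseteq> I})"
    by (rule countable_subset[of _ "PiE I (\<lambda>_. UNIV)"]) (auto intro: countable_PiE assms)
  ultimately show ?thesis
    using countable_image_inj_on by blast
qed

lemma countable_rat_polys:
  assumes "finite I"
  shows "countable {P :: ('i \<Rightarrow>\<^sub>0 nat) \<Rightarrow>\<^sub>0 rat. poly_vars P \<subseteq> I}" (is "countable ?S")
proof -
  \<comment> \<open>A polynomial is determined by the finite graph of its coefficients, and a
    countable set has only countably many finite subsets.\<close>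
  define gr where "gr P = (\<lambda>m. (m, Poly_Mapping.lookup P m)) ` Poly_Mapping.keys P"
    for P :: "('i \<Rightarrow>\<^sub>0 nat) \<Rightarrow>\<^sub>0 rat"
  have "inj_on gr ?S"
  proof (rule inj_onI, rule poly_mapping_eqI)
    fix P Q m assume "gr P = gr Q"
    then have "(m, a) \<in> gr P \<longleftrightarrow> (m, a) \<in> gr Q" for a by simp
    then show "Poly_Mapping.lookup P m = Poly_Mapping.lookup Q m"
      unfolding gr_def by (auto simp: in_keys_iff image_iff)
        (metis)
  qed
  moreover have "countable (gr ` ?S)"
  proof (rule countable_subset)
    show "gr ` ?S \<subseteq> {A. finite A \<and> A \<subseteq> {m. Poly_Mapping.keys m \<subseteq> I} \<times> UNIV}"
      by (auto simp: gr_def poly_vars_def)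
    show "countable {A. finite A \<and> A \<subseteq> {m :: 'i \<Rightarrow>\<^sub>0 nat. Poly_Mapping.keys m \<subseteq> I} \<times> (UNIV :: rat set)}"
      by (rule countable_Collect_finite_subset) (intro countable_SIGMA countable_monomials[OF assms] countableI_type)
  qed
  ultimately show ?thesis
    using countable_image_inj_on by blast
qed

text \<open>Read \<open>P\<close> as a polynomial in the variable \<open>i\<close> whose
  coefficients are polynomials over \<open>I\<close>. One of these is not the zero polynomial, so by
  independence its value at \<open>c\<close> is nonzero, and a nonzero polynomial in one variable
  has finitely many roots.\<close>

lemma finite_roots_last_variable:
  assumes c: "alg_independent_rat c I" and "i \<notin> I"
    and P: "poly_vars P \<subseteq> insert i I" "P \<noteq> 0"
  shows "finite {t. poly_eval P (c(i := t)) = 0}"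
proof -
  let ?K = "Poly_Mapping.keys P"
  define e where "e m = Poly_Mapping.lookup m i" for m :: "'a \<Rightarrow>\<^sub>0 nat"
  define r where "r m = Poly_Mapping.update i 0 m" for m :: "'a \<Rightarrow>\<^sub>0 nat"
  define Q where "Q k = (\<Sum>m\<in>{m \<in> ?K. e m = k}. Poly_Mapping.single (r m) (Poly_Mapping.lookup P m))" for k
  have lookup_r: "Poly_Mapping.lookup (r m) = (Poly_Mapping.lookup m)(i := 0)" for m
    unfolding r_def by (auto simp: lookup_update)
  have inj_r: "m = n" if "r m = r n" "e m = e n" for m n
    using that lookup_r unfolding e_def
    by (intro poly_mapping_eqI) (metis fun_upd_other)
  have eval_r: "monom_eval m (c(i := t)) = t ^ e m * monom_eval (r m) c" for m t
  proof -
    let ?A = "insert i (Poly_Mapping.keys m)"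
    have "Poly_Mapping.keys (r m) \<subseteq> ?A"
      by (auto simp: in_keys_iff lookup_r split: if_splits)
    then have "monom_eval (r m) c = (\<Prod>j\<in>?A - {i}. c j ^ Poly_Mapping.lookup m j)"
      by (subst monom_eval_superset[of ?A]) (auto simp: lookup_r prod.remove[of _ i] intro!: prod.cong)
    moreover have "monom_eval m (c(i := t)) = t ^ e m * (\<Prod>j\<in>?A - {i}. c j ^ Poly_Mapping.lookup m j)"
      by (subst monom_eval_superset[of ?A]) (auto simp: e_def prod.remove[of _ i] intro!: prod.cong)
    ultimately show ?thesis by simp
  qed
  define N where "N = Max (e ` ?K)"
  have N: "e m \<le> N" if "m \<in> ?K" for m
    using that unfolding N_def by auto
  have eval: "poly_eval P (c(i := t)) = (\<Sum>k\<le>N. poly_eval (Q k) c * t ^ k)" for t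
  proof -
    have "poly_eval P (c(i := t)) = (\<Sum>m\<in>?K. of_rat (Poly_Mapping.lookup P m) * (t ^ e m * monom_eval (r m) c))"
      by (subst poly_eval_superset[of ?K]) (auto simp: eval_r)
    also have "\<dots> = (\<Sum>k\<le>N. \<Sum>m\<in>{m \<in> ?K. e m = k}. of_rat (Poly_Mapping.lookup P m) * (t ^ e m * monom_eval (r m) c))"
      by (rule sum.group[symmetric]) (auto intro: N)
    also have "\<dots> = (\<Sum>k\<le>N. poly_eval (Q k) c * t ^ k)"
      unfolding Q_def poly_eval_sum poly_eval_single sum_distrib_right
      by (intro sum.cong) auto
    finally show ?thesis .
  qed
  obtain m where m: "m \<in> ?K" using P(2) keys_eq_empty[of P] by blast
  \<comment> \<open>Stripping the variable \<open>i\<close> is injective on monomials with the same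
    exponent of \<open>i\<close>, so no terms of \<open>Q (e m)\<close> merge and the coefficient of
    \<open>m\<close> survives.\<close>
  have "Poly_Mapping.lookup (Q (e m)) (r m) = Poly_Mapping.lookup P m"
  proof -
    have "Poly_Mapping.lookup (Q (e m)) (r m)
        = (\<Sum>n\<in>{n \<in> ?K. e n = e m}. if n = m then Poly_Mapping.lookup P n else 0)"
      unfolding Q_def lookup_sum by (intro sum.cong) (auto simp: lookup_single when_def dest: inj_r)
    also have "\<dots> = Poly_Mapping.lookup P m" using m by simp
    finally show ?thesis .
  qed
  then have "Q (e m) \<noteq> 0" using m by (auto simp: in_keys_iff)
  moreover have "poly_vars (Q (e m)) \<subseteq> I"
  proof -
    have "Poly_Mapping.keys (Q (e m)) \<subseteq> r ` ?K"
      unfolding Q_def using Poly_Mapping.keys_sum[of "\<lambda>m. Poly_Mapping.single (r m) (Poly_Mapping.lookup P m)" "{n \<in> ?K. e n = e m}"]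
      by (auto split: if_splits)
    moreover have "Poly_Mapping.keys (r n) \<subseteq> I" if "n \<in> ?K" for n
    proof -
      have "Poly_Mapping.keys (r n) \<subseteq> Poly_Mapping.keys n - {i}"
        by (auto simp: in_keys_iff lookup_r split: if_splits)
      also have "\<dots> \<subseteq> I" using that P(1) by (auto simp: poly_vars_def)
      finally show ?thesis .
    qed
    ultimately show ?thesis unfolding poly_vars_def by blast
  qed
  ultimately have "poly_eval (Q (e m)) c \<noteq> 0"
    using c unfolding alg_independent_rat_def by blast
  then show ?thesis
    unfolding eval using polyfun_finite_roots[of "\<lambda>k. poly_eval (Q k) c" N] N[OF m] by blast
qed

text \<open>Choose one coordinate at a time: countably many polynomials each forbid finitely many
  values, and the reals are uncountable.\<close>

lemma alg_independent_rat_exists: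
  assumes "finite I"
  shows "\<exists>c :: 'i \<Rightarrow> real. alg_independent_rat c I"
  using assms
proof (induction I)
  case empty
  have "P = 0" if "poly_vars P \<subseteq> {}" "poly_eval P c = 0" for P and c :: "'i \<Rightarrow> real"
  proof -
    have K: "Poly_Mapping.keys P \<subseteq> {0}" using that(1) by (auto simp: poly_vars_def)
    then have "Poly_Mapping.lookup P 0 = 0"
      using that(2) by (subst (asm) poly_eval_superset[of "{0}"]) (auto simp: monom_eval_def)
    then show ?thesis using K by (metis in_keys_iff keys_eq_empty singletonD subsetD subset_singletonD insertI1)
  qed
  then show ?case unfolding alg_independent_rat_def by blast
next
  case (insert i I)
  then obtain c :: "'i \<Rightarrow> real" where c: "alg_independent_rat c I" by blast
  let ?B = "\<Union>P \<in> {P. poly_vars P \<subseteq> insert i I} - {0}. {t. poly_eval P (c(i := t)) = 0}"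
  have "countable ?B"
    using insert.hyps c by (intro countable_UN countable_Diff countable_rat_polys countable_finite)
      (auto intro: finite_roots_last_variable)
  then obtain t where "t \<notin> ?B" using uncountable_UNIV_real by (metis UNIV_eq_I)
  then have "alg_independent_rat (c(i := t)) (insert i I)"
    unfolding alg_independent_rat_def by auto
  then show ?case by blast
qed

section \<open>Independence of rows at generic points\<close>

text \<open>Gaussian elimination without division. Multiplying by the pivot keeps the entries
  polynomial in the coordinates, as \<open>rows_independent_generic\<close> requires.\<close>

lemma rows_independent_pivot:
  assumes X: "finite X" "x \<in> X" and c: "c \<in> C" "M x c \<noteq> 0"
  shows "rows_independent M C X \<longleftrightarrow>
    rows_independent (\<lambda>y d. M y d * M x c - M y c * M x d) (C - {c}) (X - {x})"
    (is "_ \<longleftrightarrow> rows_independent ?M' _ _")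
proof
  have sum_X: "(\<Sum>y\<in>X. f y) = f x + (\<Sum>y\<in>X - {x}. f y)" for f :: "_ \<Rightarrow> real"
    using X by (rule sum.remove)
  show "rows_independent ?M' (C - {c}) (X - {x})" if ind: "rows_independent M C X"
    unfolding rows_independent_def
  proof (intro allI impI)
    fix b assume b: "\<forall>d\<in>C - {c}. (\<Sum>y\<in>X - {x}. b y * ?M' y d) = 0"
    \<comment> \<open>The coefficient of row \<open>x\<close> is chosen so that column
      \<open>c\<close> cancels; the other columns then reproduce the combination of the eliminated
      rows.\<close>
    define a where "a y = (if y = x then - (\<Sum>y\<in>X - {x}. b y * M y c) else b y * M x c)" for y
    have "(\<Sum>y\<in>X. a y * M y d) = 0" if "d \<in> C" for d
    proof -
      have "(\<Sum>y\<in>X. a y * M y d) = (\<Sum>y\<in>X - {x}. b y * ?M' y d)"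
        unfolding sum_X by (simp add: a_def sum_distrib_left sum_distrib_right sum_subtractf algebra_simps)
      also have "\<dots> = 0" using b that by (cases "d = c") auto
      finally show ?thesis .
    qed
    then have "\<forall>y\<in>X. a y = 0" using ind unfolding rows_independent_def by blast
    then show "\<forall>y\<in>X - {x}. b y = 0" using c(2) by (auto simp: a_def split: if_splits)
  qed
  show "rows_independent M C X" if ind: "rows_independent ?M' (C - {c}) (X - {x})"
    unfolding rows_independent_def
  proof (intro allI impI)
    fix a assume a: "\<forall>d\<in>C. (\<Sum>y\<in>X. a y * M y d) = 0"
    have rest: "(\<Sum>y\<in>X - {x}. a y * M y d) = - a x * M x d" if "d \<in> C" for d
      using a that by (simp add: sum_X eq_neg_iff_add_eq_0 add.commute)
    have "(\<Sum>y\<in>X - {x}. a y * ?M' y d) = 0" if "d \<in> C" for d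
    proof -
      have "(\<Sum>y\<in>X - {x}. a y * ?M' y d) =
          (\<Sum>y\<in>X - {x}. a y * M y d) * M x c - (\<Sum>y\<in>X - {x}. a y * M y c) * M x d"
        by (simp add: sum_distrib_left sum_distrib_right sum_subtractf algebra_simps)
      then show ?thesis using rest[OF that] rest[OF c(1)] by simp
    qed
    then have zero: "\<forall>y\<in>X - {x}. a y = 0" using ind unfolding rows_independent_def by blast
    then have "a x * M x c = 0" using rest[OF c(1)] by simp
    then show "\<forall>y\<in>X. a y = 0" using zero c(2) by auto
  qed
qed

lemma rows_independent_nonzero_entry:
  assumes "rows_independent M C X" "finite X" "x \<in> X"
  obtains c where "c \<in> C" "M x c \<noteq> 0"
proof -
  have "\<exists>c\<in>C. M x c \<noteq> 0"
  proof (rule ccontr)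
    assume "\<not> ?thesis"
    then have "\<forall>c\<in>C. (\<Sum>y\<in>X. of_bool (y = x) * M y c) = 0"
      by (auto intro!: sum.neutral)
    then have "\<forall>y\<in>X. of_bool (y = x) = (0 :: real)"
      using assms(1)[unfolded rows_independent_def, THEN spec, of "\<lambda>y. of_bool (y = x)"] by blast
    then show False using assms(3) by auto
  qed
  then show ?thesis using that by blast
qed

lemma rows_independent_card_le:
  assumes "finite X" "finite C" "rows_independent M C X"
  shows "card X \<le> card C"
  using assms
proof (induction X arbitrary: M C rule: finite_induct)
  case (insert x X)
  obtain c where c: "c \<in> C" "M x c \<noteq> 0"
    using rows_independent_nonzero_entry[OF insert.prems(2), of x] insert.hyps by auto
  then have "rows_independent (\<lambda>y d. M y d * M x c - M y c * M x d) (C - {c}) X"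
    using insert.hyps insert.prems rows_independent_pivot[of "insert x X" x c C M] by simp
  then have "card X \<le> card (C - {c})"
    using insert.prems(1) by (intro insert.IH) auto
  then show ?case
    using insert.hyps card.remove[OF insert.prems(1) c(1)] by (simp del: card_Diff_insert)
qed simp

text \<open>Elimination can use the same pivots at \<open>z'\<close> and at \<open>z\<close>: a
  pivot that is nonzero at \<open>z'\<close> is a nonzero polynomial, hence nonzero at the
  algebraically independent point \<open>z\<close>.\<close>

lemma rows_independent_generic:
  assumes "finite X" "alg_independent_rat z I"
    and "\<And>x c. x \<in> X \<Longrightarrow> c \<in> C \<Longrightarrow> rat_poly_fun I (\<lambda>z. M z x c)"
    and "rows_independent (M z') C X"
  shows "rows_independent (M z) C X"
  using assms
proof (induction X arbitrary: M C rule: finite_induct)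
  case empty
  then show ?case by (simp add: rows_independent_def)
next
  case (insert x X)
  obtain c where c: "c \<in> C" "M z' x c \<noteq> 0"
    using rows_independent_nonzero_entry[OF insert.prems(3), of x] insert.hyps by auto
  have nz: "M z x c \<noteq> 0"
    using c insert.prems(2)[of x c] alg_independent_rat_poly_fun[OF insert.prems(1)] by auto
  let ?M' = "\<lambda>z y d. M z y d * M z x c - M z y c * M z x d"
  have "rows_independent (?M' z) (C - {c}) X"
  proof (rule insert.IH)
    show "rat_poly_fun I (\<lambda>z. ?M' z y d)" if "y \<in> X" "d \<in> C - {c}" for y d
      using that c(1) by (intro rat_poly_fun_diff rat_poly_fun_mult insert.prems(2)) auto
    show "rows_independent (?M' z') (C - {c}) X"
      using rows_independent_pivot[of "insert x X" x c C "M z'"] c insert by auto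
  qed (rule insert.prems)
  then show ?case
    using rows_independent_pivot[of "insert x X" x c C "M z"] c nz insert.hyps by auto
qed

section \<open>Stresses\<close>

definition nbrs :: "'v set set \<Rightarrow> 'v \<Rightarrow> 'v set" where
  "nbrs E w = {u. {u, w} \<in> E}"

lemma bij_betw_nbrs:
  assumes "\<forall>e\<in>E. card e = 2"
  shows "bij_betw (\<lambda>u. {u, w}) (nbrs E w) {e \<in> E. w \<in> e}"
  unfolding bij_betw_def
proof (intro conjI equalityI subsetI)
  show "inj_on (\<lambda>u. {u, w}) (nbrs E w)"
    by (intro inj_onI) (metis doubleton_eq_iff)
  show "e \<in> (\<lambda>u. {u, w}) ` nbrs E w" if "e \<in> {e \<in> E. w \<in> e}" for e
  proof -
    have "card (e - {w}) = 1" using assms that by simp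
    then obtain u where "e - {w} = {u}" by (auto simp: card_1_singleton_iff)
    then have "e = {u, w}" using that by blast
    then show ?thesis using that by (auto simp: nbrs_def)
  qed
qed (auto simp: nbrs_def)

lemma self_notin_nbrs: "\<forall>e\<in>E. card e = 2 \<Longrightarrow> w \<notin> nbrs E w"
  by (auto simp: nbrs_def)

lemma finite_nbrs:
  assumes "finite E" "\<forall>e\<in>E. card e = 2"
  shows "finite (nbrs E w)"
proof -
  have "finite {e \<in> E. w \<in> e}" using assms(1) by simp
  then show ?thesis using bij_betw_nbrs[OF assms(2), of w] bij_betw_finite by blast
qed

lemma card_nbrs:
  assumes "\<forall>e\<in>E. card e = 2"
  shows "card (nbrs E w) = card {e \<in> E. w \<in> e}"
  by (rule bij_betw_same_card[OF bij_betw_nbrs[OF assms]])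

text \<open>A stress assigns coefficients \<open>\<omega>\<close> to edges and \<open>\<mu>\<close> to loops; its vanishing at every vertex
  is a linear dependence between the rows of the rigidity matrix.\<close>

definition stress_at :: "('v \<Rightarrow> real^'d) \<Rightarrow> ('l \<Rightarrow> real^'d) \<Rightarrow> ('l \<Rightarrow> 'v) \<Rightarrow> 'v set set \<Rightarrow> 'l set \<Rightarrow>
    ('v set \<Rightarrow> real) \<Rightarrow> ('l \<Rightarrow> real) \<Rightarrow> 'v \<Rightarrow> real^'d" where
  "stress_at p q lv E L \<omega> \<mu> w = (\<Sum>u\<in>nbrs E w. \<omega> {u, w} *\<^sub>R (p w - p u)) +
     (\<Sum>l\<in>{l \<in> L. lv l = w}. \<mu> l *\<^sub>R q l)"

text \<open>No vertex set is mentioned, since the condition is void at a vertex without edges and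
  loops. Deleting a vertex therefore changes only \<open>E\<close> and \<open>L\<close>.\<close>

definition stress_free :: "('v \<Rightarrow> real^'d) \<Rightarrow> ('l \<Rightarrow> real^'d) \<Rightarrow> ('l \<Rightarrow> 'v) \<Rightarrow> 'v set set \<Rightarrow> 'l set \<Rightarrow> bool" where
  "stress_free p q lv E L \<longleftrightarrow> (\<forall>\<omega> \<mu>. (\<forall>w. stress_at p q lv E L \<omega> \<mu> w = 0) \<longrightarrow>
     (\<forall>e\<in>E. \<omega> e = 0) \<and> (\<forall>l\<in>L. \<mu> l = 0))"

lemma rigidity_matrix_row_combination:
  fixes p :: "'v \<Rightarrow> real^'d"
  assumes "finite E" "finite L" "\<forall>e\<in>E. card e = 2"
  shows "(\<Sum>x\<in>E <+> L. a x * rigidity_matrix G p q x (w, i)) =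
    stress_at p q (loop_vertex G) E L (\<lambda>e. a (Inl e)) (\<lambda>l. a (Inr l)) w $ i"
proof -
  have "(\<Sum>e\<in>E. a (Inl e) * rigidity_matrix G p q (Inl e) (w, i)) =
      (\<Sum>e\<in>{e \<in> E. w \<in> e}. a (Inl e) * (\<Sum>u\<in>e - {w}. p w - p u) $ i)"
    using assms(1) by (auto intro!: sum.mono_neutral_cong_right split: if_splits)
  also have "\<dots> = (\<Sum>u\<in>nbrs E w. a (Inl {u, w}) * (p w - p u) $ i)"
  proof (subst sum.reindex_bij_betw[OF bij_betw_nbrs[OF assms(3)], symmetric], rule sum.cong)
    fix u assume "u \<in> nbrs E w"
    then have "{u, w} - {w} = {u}" using self_notin_nbrs[OF assms(3)] by auto
    then show "a (Inl {u, w}) * (\<Sum>u\<in>{u, w} - {w}. p w - p u) $ i = a (Inl {u, w}) * (p w - p u) $ i"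
      by simp
  qed simp
  finally have 1: "(\<Sum>e\<in>E. a (Inl e) * rigidity_matrix G p q (Inl e) (w, i)) = \<dots>" .
  have 2: "(\<Sum>l\<in>L. a (Inr l) * rigidity_matrix G p q (Inr l) (w, i)) =
      (\<Sum>l\<in>{l \<in> L. loop_vertex G l = w}. a (Inr l) * q l $ i)"
    using assms(2) by (auto intro!: sum.mono_neutral_cong_right split: if_splits)
  show ?thesis
    using assms by (simp add: sum.Plus 1 2 stress_at_def del: rigidity_matrix.simps)
qed

lemma stress_free_iff_rows_independent:
  fixes p :: "'v \<Rightarrow> real^'d"
  assumes "finite E" "finite L" "\<forall>e\<in>E. e \<subseteq> V \<and> card e = 2" "\<forall>l\<in>L. loop_vertex G l \<in> V"
  shows "rows_independent (rigidity_matrix G p q) (V \<times> UNIV) (E <+> L) \<longleftrightarrow>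
    stress_free p q (loop_vertex G) E L"
proof -
  have card2: "\<forall>e\<in>E. card e = 2" using assms(3) by blast
  have outside: "stress_at p q (loop_vertex G) E L \<omega> \<mu> w = 0" if "w \<notin> V" for \<omega> \<mu> w
  proof -
    have "nbrs E w = {}" "{l \<in> L. loop_vertex G l = w} = {}"
      using assms(3,4) that unfolding nbrs_def by fastforce+
    then show ?thesis unfolding stress_at_def by (simp only: sum.empty add_0)
  qed
  have iff: "(\<forall>c\<in>V \<times> UNIV. (\<Sum>x\<in>E <+> L. a x * rigidity_matrix G p q x c) = 0) \<longleftrightarrow>
      (\<forall>w. stress_at p q (loop_vertex G) E L (\<lambda>e. a (Inl e)) (\<lambda>l. a (Inr l)) w = 0)" for a
    using outside
    by (auto simp: rigidity_matrix_row_combination[OF assms(1,2) card2] vec_eq_iff)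
  show ?thesis
  proof
    assume l: "rows_independent (rigidity_matrix G p q) (V \<times> UNIV) (E <+> L)"
    show "stress_free p q (loop_vertex G) E L"
      unfolding stress_free_def
    proof (intro allI impI)
      fix \<omega> \<mu> assume "\<forall>w. stress_at p q (loop_vertex G) E L \<omega> \<mu> w = 0"
      then have "\<forall>x\<in>E <+> L. case_sum \<omega> \<mu> x = 0"
        using l iff[of "case_sum \<omega> \<mu>"] unfolding rows_independent_def by auto
      then show "(\<forall>e\<in>E. \<omega> e = 0) \<and> (\<forall>l\<in>L. \<mu> l = 0)" by force
    qed
  next
    assume "stress_free p q (loop_vertex G) E L"
    then show "rows_independent (rigidity_matrix G p q) (V \<times> UNIV) (E <+> L)"
      unfolding rows_independent_def iff stress_free_def by blast
  qed
qed

text \<open>Detached from a graph, so that a single placement stays generic on the original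
  \<open>V\<close> and \<open>L\<close> while an induction shrinks and alters the graph.\<close>

abbreviation generic_on :: "'v set \<Rightarrow> 'l set \<Rightarrow> ('v \<Rightarrow> real^'d) \<Rightarrow> ('l \<Rightarrow> real^'d) \<Rightarrow> bool" where
  "generic_on V L p q \<equiv>
     alg_independent_rat (\<lambda>(x, i). case_sum p q x $ i) ((V <+> L) \<times> UNIV)"

lemma generic_on_exists:
  assumes "finite V" "finite L"
  shows "\<exists>(p :: 'v \<Rightarrow> real^'d) (q :: 'l \<Rightarrow> real^'d). generic_on V L p q"
proof -
  obtain c :: "('v + 'l) \<times> 'd \<Rightarrow> real" where c: "alg_independent_rat c ((V <+> L) \<times> UNIV)"
    using alg_independent_rat_exists[of "(V <+> L) \<times> (UNIV :: 'd set)"] assms by auto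
  have "(\<lambda>(x, i). case_sum (\<lambda>v. \<chi> i. c (Inl v, i)) (\<lambda>l. \<chi> i. c (Inr l, i)) x $ i) = c"
    by (auto split: sum.splits)
  then show ?thesis using c by metis
qed

text \<open>This permits an extension step to put its new vertex at a convenient special
  position.\<close>

lemma stress_free_generic:
  fixes p p' :: "'v \<Rightarrow> real^'d" and q q' :: "'l \<Rightarrow> real^'d"
  assumes fin: "finite E" "finite M" and E: "\<forall>e\<in>E. e \<subseteq> V \<and> card e = 2"
    and M: "M \<subseteq> L" "\<forall>l\<in>M. lv l \<in> V"
    and gen: "generic_on V L p q" and "stress_free p' q' lv E M"
  shows "stress_free p q lv E M"
proof -
  define G where "G = \<lparr>verts = V, edges = E, loops = L, loop_vertex = lv\<rparr>"
  define R where "R z = rigidity_matrix G (\<lambda>v. \<chi> i. z (Inl v, i)) (\<lambda>l. \<chi> i. z (Inr l, i))"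
    for z :: "('v + 'l) \<times> 'd \<Rightarrow> real"
  have R: "R (\<lambda>(x, i). case_sum p q x $ i) = rigidity_matrix G p q" for p q
    unfolding R_def by simp
  have iff: "rows_independent (R (\<lambda>(x, i). case_sum p q x $ i)) (V \<times> UNIV) (E <+> M) \<longleftrightarrow>
      stress_free p q lv E M" for p q
    unfolding R using stress_free_iff_rows_independent[of E M V G p q] assms by (simp add: G_def)
  have "rows_independent (R (\<lambda>(x, i). case_sum p q x $ i)) (V \<times> UNIV) (E <+> M)"
  proof (rule rows_independent_generic[OF _ gen])
    fix x c assume x: "x \<in> E <+> M" and c: "c \<in> V \<times> (UNIV :: 'd set)"
    obtain v i where [simp]: "c = (v, i)" and v: "v \<in> V" using c by auto
    show "rat_poly_fun ((V <+> L) \<times> UNIV) (\<lambda>z. R z x c)"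
    proof (cases x)
      case (Inl e)
      with x E have "e \<subseteq> V" by auto
      then have "rat_poly_fun ((V <+> L) \<times> UNIV) (\<lambda>z. \<Sum>u\<in>e - {v}. z (Inl v, i) - z (Inl u, i))"
        using v by (intro rat_poly_fun_sum rat_poly_fun_diff rat_poly_fun_var) auto
      then show ?thesis
        by (cases "v \<in> e") (simp_all add: Inl R_def rat_poly_fun_0)
    next
      case (Inr l)
      then show ?thesis
        using x M by (cases "v = lv l")
          (auto simp: R_def G_def rat_poly_fun_0 intro!: rat_poly_fun_var)
    qed
  next
    show "finite (E <+> M)" using fin by simp
    show "rows_independent (R (\<lambda>(x, i). case_sum p' q' x $ i)) (V \<times> UNIV) (E <+> M)"
      using assms(7) by (simp only: iff)
  qed
  then show ?thesis by (simp only: iff)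
qed

section \<open>General position in the plane\<close>

definition cross :: "real^2 \<Rightarrow> real^2 \<Rightarrow> real" where
  "cross x y = x $ 1 * y $ 2 - x $ 2 * y $ 1"

lemma cross_scaleR [simp]: "cross (a *\<^sub>R x) y = a * cross x y" "cross x (a *\<^sub>R y) = a * cross x y"
  by (auto simp: cross_def algebra_simps)

lemma cross_add: "cross (x + x') y = cross x y + cross x' y" "cross x (y + y') = cross x y + cross x y'"
  by (auto simp: cross_def algebra_simps)

lemma cross_diff: "cross (x - x') y = cross x y - cross x' y" "cross x (y - y') = cross x y - cross x y'"
  by (auto simp: cross_def algebra_simps)

lemma cross_self [simp]: "cross x x = 0" and cross_0 [simp]: "cross 0 x = 0" "cross x 0 = 0"
  by (auto simp: cross_def)

lemma cross_commute: "cross y x = - cross x y"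
  by (simp add: cross_def)

lemma cross_nonzero_independent:
  assumes "cross x y \<noteq> 0" "a *\<^sub>R x + b *\<^sub>R y = 0"
  shows "a = 0" "b = 0"
proof -
  have "cross (a *\<^sub>R x + b *\<^sub>R y) y = 0" "cross x (a *\<^sub>R x + b *\<^sub>R y) = 0"
    using assms(2) by simp_all
  then show "a = 0" "b = 0" using assms(1) by (simp_all add: cross_add)
qed

text \<open>These are the nondegeneracies that the extension steps need. They ignore where the loops
  sit, because the induction moves loops between vertices.\<close>

definition general_position :: "'v set \<Rightarrow> 'l set \<Rightarrow> ('v \<Rightarrow> real^2) \<Rightarrow> ('l \<Rightarrow> real^2) \<Rightarrow> bool" where
  "general_position V L p q \<longleftrightarrow>
     (\<forall>a\<in>V. \<forall>b\<in>V. \<forall>c\<in>V. a \<noteq> b \<and> a \<noteq> c \<and> b \<noteq> c \<longrightarrow> cross (p a - p b) (p a - p c) \<noteq> 0) \<and>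
     (\<forall>a\<in>V. \<forall>b\<in>V. \<forall>l\<in>L. a \<noteq> b \<longrightarrow> cross (p a - p b) (q l) \<noteq> 0) \<and>
     (\<forall>l\<in>L. \<forall>m\<in>L. l \<noteq> m \<longrightarrow> cross (q l) (q m) \<noteq> 0) \<and>
     (\<forall>a\<in>V. \<forall>b\<in>V. a \<noteq> b \<longrightarrow> p a \<noteq> p b) \<and> (\<forall>l\<in>L. q l \<noteq> 0)"

lemma generic_on_general_position:
  fixes p :: "'v \<Rightarrow> real^2"
  assumes gen: "generic_on V L p q"
  shows "general_position V L p q"
proof -
  let ?I = "(V <+> L) \<times> (UNIV :: 2 set)"
  let ?z = "\<lambda>(x, i). case_sum p q x $ i"
  have nz: "f ?z \<noteq> 0" if "f z' \<noteq> 0" "rat_poly_fun ?I f" for f z'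
    using alg_independent_rat_poly_fun[OF gen that(2)] that(1) by blast
  note poly = rat_poly_fun_diff rat_poly_fun_mult rat_poly_fun_var
  have 1: "cross (p a - p b) (p a - p c) \<noteq> 0"
    if "a \<in> V" "b \<in> V" "c \<in> V" "a \<noteq> b" "a \<noteq> c" "b \<noteq> c" for a b c
  proof -
    let ?f = "\<lambda>z. (z (Inl a, 1) - z (Inl b, 1)) * (z (Inl a, 2) - z (Inl c, 2)) -
        (z (Inl a, 2) - z (Inl b, 2)) * (z (Inl a, 1) - z (Inl c, 1))"
    \<comment> \<open>The test point has \<open>a\<close> at the origin and \<open>b\<close>,
      \<open>c\<close> at the two unit vectors; the later test points are of the same kind.\<close>
    have "?f ?z \<noteq> 0"
      by (rule nz[where f = ?f and z' = "\<lambda>x. if x = (Inl b, 1) \<or> x = (Inl c, 2) then 1 else 0"], use that in simp)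
        (intro poly; use that in \<open>simp add: InlI InrI\<close>)
    then show ?thesis by (simp add: cross_def)
  qed
  have 2: "cross (p a - p b) (q l) \<noteq> 0" if "a \<in> V" "b \<in> V" "l \<in> L" "a \<noteq> b" for a b l
  proof -
    let ?f = "\<lambda>z. (z (Inl a, 1) - z (Inl b, 1)) * z (Inr l, 2) -
        (z (Inl a, 2) - z (Inl b, 2)) * z (Inr l, 1)"
    have "?f ?z \<noteq> 0"
      by (rule nz[where f = ?f and z' = "\<lambda>x. if x = (Inl b, 1) \<or> x = (Inr l, 2) then 1 else 0"], use that in simp)
        (intro poly; use that in \<open>simp add: InlI InrI\<close>)
    then show ?thesis by (simp add: cross_def)
  qed
  have 3: "cross (q l) (q m) \<noteq> 0" if "l \<in> L" "m \<in> L" "l \<noteq> m" for l m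
  proof -
    let ?f = "\<lambda>z. z (Inr l, 1) * z (Inr m, 2) - z (Inr l, 2) * z (Inr m, 1)"
    have "?f ?z \<noteq> 0"
      by (rule nz[where f = ?f and z' = "\<lambda>x. if x = (Inr l, 1) \<or> x = (Inr m, 2) then 1 else 0"], use that in simp)
        (intro poly; use that in \<open>simp add: InlI InrI\<close>)
    then show ?thesis by (simp add: cross_def)
  qed
  have 4: "p a \<noteq> p b" if "a \<in> V" "b \<in> V" "a \<noteq> b" for a b
  proof -
    let ?f = "\<lambda>z. z (Inl a, 1) - z (Inl b, 1)"
    have "?f ?z \<noteq> 0"
      by (rule nz[where f = ?f and z' = "\<lambda>x. if x = (Inl a, 1) then 1 else 0"], use that in simp)
        (intro poly; use that in \<open>simp add: InlI InrI\<close>)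
    then show ?thesis by auto
  qed
  have 5: "q l \<noteq> 0" if "l \<in> L" for l
  proof -
    let ?f = "\<lambda>z. z (Inr l, 1)"
    have "?f ?z \<noteq> 0"
      by (rule nz[where f = ?f and z' = "\<lambda>x. 1"], simp) (intro poly; use that in \<open>simp add: InlI InrI\<close>)
    then show ?thesis by auto
  qed
  show ?thesis
    unfolding general_position_def by (intro conjI ballI impI) (simp_all add: 1 2 3 4 5)
qed

section \<open>Extensions by one vertex\<close>

lemma stress_at_remove_vertex:
  assumes "finite E" "\<forall>e\<in>E. card e = 2" "w \<noteq> v"
  shows "stress_at p q lv E M \<omega> \<mu> w =
    stress_at p q lv {e \<in> E. v \<notin> e} {l \<in> M. lv l \<noteq> v} \<omega> \<mu> w +
    (if w \<in> nbrs E v then \<omega> {w, v} *\<^sub>R (p w - p v) else 0)"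
proof -
  let ?E = "{e \<in> E. v \<notin> e}"
  have "finite (nbrs ?E w)" using assms by (intro finite_nbrs) auto
  moreover have "nbrs E w = (if w \<in> nbrs E v then insert v (nbrs ?E w) else nbrs ?E w)"
    using assms(3) by (auto simp: nbrs_def insert_commute)
  moreover have "v \<notin> nbrs ?E w" by (simp add: nbrs_def)
  moreover have "{l \<in> {l \<in> M. lv l \<noteq> v}. lv l = w} = {l \<in> M. lv l = w}"
    using assms(3) by auto
  ultimately show ?thesis
    by (simp add: stress_at_def insert_commute)
qed

lemma stress_at_removed_vertex:
  "stress_at p q lv {e \<in> E. v \<notin> e} {l \<in> M. lv l \<noteq> v} \<omega> \<mu> v = 0"
  by (simp add: stress_at_def nbrs_def)

lemma stress_at_upd_removed:
  assumes "w \<noteq> v"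
  shows "stress_at (p(v := x)) q lv {e \<in> E. v \<notin> e} M \<omega> \<mu> w = stress_at p q lv {e \<in> E. v \<notin> e} M \<omega> \<mu> w"
proof -
  have "v \<notin> nbrs {e \<in> E. v \<notin> e} w" by (simp add: nbrs_def)
  then have "(\<Sum>u\<in>nbrs {e \<in> E. v \<notin> e} w. \<omega> {u, w} *\<^sub>R ((p(v := x)) w - (p(v := x)) u)) =
      (\<Sum>u\<in>nbrs {e \<in> E. v \<notin> e} w. \<omega> {u, w} *\<^sub>R (p w - p u))"
    using assms by (intro sum.cong refl) auto
  then show ?thesis by (simp add: stress_at_def)
qed

lemma stress_freeI_vertex:
  assumes E: "finite E" "\<forall>e\<in>E. card e = 2"
    and "\<And>\<omega> \<mu>. (\<And>w. stress_at p q lv E M \<omega> \<mu> w = 0) \<Longrightarrow>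
      (\<forall>e\<in>E. v \<notin> e \<longrightarrow> \<omega> e = 0) \<and> (\<forall>l\<in>M. lv l \<noteq> v \<longrightarrow> \<mu> l = 0) \<and>
      (\<forall>u\<in>nbrs E v. \<omega> {u, v} = 0) \<and> (\<forall>l\<in>M. lv l = v \<longrightarrow> \<mu> l = 0)"
  shows "stress_free p q lv E M"
  unfolding stress_free_def
proof (intro allI impI)
  fix \<omega> \<mu> assume "\<forall>w. stress_at p q lv E M \<omega> \<mu> w = 0"
  then have *: "(\<forall>e\<in>E. v \<notin> e \<longrightarrow> \<omega> e = 0) \<and> (\<forall>l\<in>M. lv l \<noteq> v \<longrightarrow> \<mu> l = 0) \<and>
      (\<forall>u\<in>nbrs E v. \<omega> {u, v} = 0) \<and> (\<forall>l\<in>M. lv l = v \<longrightarrow> \<mu> l = 0)"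
    using assms(3) by blast
  moreover have "\<omega> e = 0" if "e \<in> E" "v \<in> e" for e
  proof -
    have "e \<in> (\<lambda>u. {u, v}) ` nbrs E v"
      using bij_betw_imp_surj_on[OF bij_betw_nbrs[OF E(2)], of v] that by blast
    then show ?thesis using * by auto
  qed
  ultimately show "(\<forall>e\<in>E. \<omega> e = 0) \<and> (\<forall>l\<in>M. \<mu> l = 0)" by blast
qed

text \<open>Once the coefficients at \<open>v\<close> are zero, the conditions at the other vertices
  are those of the graph without \<open>v\<close>.\<close>

lemma stress_free_add_vertex:
  assumes E: "finite E" "\<forall>e\<in>E. card e = 2"
    and sf: "stress_free p q lv {e \<in> E. v \<notin> e} {l \<in> M. lv l \<noteq> v}"
    and v: "\<And>\<omega> \<mu>. stress_at p q lv E M \<omega> \<mu> v = 0 \<Longrightarrow>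
      (\<forall>u\<in>nbrs E v. \<omega> {u, v} = 0) \<and> (\<forall>l\<in>M. lv l = v \<longrightarrow> \<mu> l = 0)"
  shows "stress_free p q lv E M"
proof (rule stress_freeI_vertex[OF E])
  fix \<omega> \<mu> assume 0: "\<And>w. stress_at p q lv E M \<omega> \<mu> w = 0"
  note at_v = v[OF 0]
  have "stress_at p q lv {e \<in> E. v \<notin> e} {l \<in> M. lv l \<noteq> v} \<omega> \<mu> w = 0" for w
  proof (cases "w = v")
    case True
    then show ?thesis by (simp only: stress_at_removed_vertex)
  next
    case False
    then show ?thesis
      using stress_at_remove_vertex[OF E False, of p q lv M \<omega> \<mu>] 0[of w] at_v by (auto split: if_splits)
  qed
  then have "(\<forall>e\<in>{e \<in> E. v \<notin> e}. \<omega> e = 0) \<and> (\<forall>l\<in>{l \<in> M. lv l \<noteq> v}. \<mu> l = 0)"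
    using sf unfolding stress_free_def by blast
  then show "(\<forall>e\<in>E. v \<notin> e \<longrightarrow> \<omega> e = 0) \<and> (\<forall>l\<in>M. lv l \<noteq> v \<longrightarrow> \<mu> l = 0) \<and>
      (\<forall>u\<in>nbrs E v. \<omega> {u, v} = 0) \<and> (\<forall>l\<in>M. lv l = v \<longrightarrow> \<mu> l = 0)"
    using at_v by blast
qed

lemma general_positionD:
  assumes "general_position V L p q"
  shows "a \<in> V \<Longrightarrow> b \<in> V \<Longrightarrow> c \<in> V \<Longrightarrow> a \<noteq> b \<Longrightarrow> a \<noteq> c \<Longrightarrow> b \<noteq> c \<Longrightarrow> cross (p a - p b) (p a - p c) \<noteq> 0"
    and "a \<in> V \<Longrightarrow> b \<in> V \<Longrightarrow> l \<in> L \<Longrightarrow> a \<noteq> b \<Longrightarrow> cross (p a - p b) (q l) \<noteq> 0"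
    and "l \<in> L \<Longrightarrow> m \<in> L \<Longrightarrow> l \<noteq> m \<Longrightarrow> cross (q l) (q m) \<noteq> 0"
    and "a \<in> V \<Longrightarrow> b \<in> V \<Longrightarrow> a \<noteq> b \<Longrightarrow> p a \<noteq> p b"
    and "l \<in> L \<Longrightarrow> q l \<noteq> 0"
  using assms by (simp_all add: general_position_def)

lemma card_le_2_cases:
  assumes "finite A" "card A \<le> 2"
  obtains "A = {}" | a where "A = {a}" | a b where "A = {a, b}" "a \<noteq> b"
proof -
  consider "card A = 0" | "card A = 1" | "card A = 2" using assms(2) by linarith
  then show ?thesis
    using that assms(1) by cases (auto simp: card_1_singleton_iff card_2_iff)
qed

text \<open>At most two vectors act at \<open>v\<close>, and general position makes them linearly
  independent, so the condition at \<open>v\<close> alone forces their coefficients to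
  vanish.\<close>

lemma stress_free_0_extension:
  assumes E: "finite E" "\<forall>e\<in>E. e \<subseteq> V \<and> card e = 2" and M: "finite M" "M \<subseteq> L"
    and gp: "general_position V L p q" and "v \<in> V"
    and sf: "stress_free p q lv {e \<in> E. v \<notin> e} {l \<in> M. lv l \<noteq> v}"
    and deg: "card (nbrs E v) + card {l \<in> M. lv l = v} \<le> 2"
  shows "stress_free p q lv E M"
proof (rule stress_free_add_vertex[OF E(1) _ sf])
  show E2: "\<forall>e\<in>E. card e = 2" using E(2) by blast
  fix \<omega> \<mu> assume 0: "stress_at p q lv E M \<omega> \<mu> v = 0"
  define K where "K = {l \<in> M. lv l = v}"
  have N: "nbrs E v \<subseteq> V - {v}" using E(2) self_notin_nbrs[OF E2] by (auto simp: nbrs_def)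
  have K: "K \<subseteq> L" using M(2) by (auto simp: K_def)
  have fin: "finite (nbrs E v)" "finite K" using finite_nbrs[OF E(1) E2] M(1) by (auto simp: K_def)
  have 0: "(\<Sum>u\<in>nbrs E v. \<omega> {u, v} *\<^sub>R (p v - p u)) + (\<Sum>l\<in>K. \<mu> l *\<^sub>R q l) = 0"
    using 0 by (simp add: stress_at_def K_def)
  have deg: "card (nbrs E v) + card K \<le> 2" using deg by (simp add: K_def)
  have gp1: "cross (p v - p a) (p v - p b) \<noteq> 0" if "a \<in> nbrs E v" "b \<in> nbrs E v" "a \<noteq> b" for a b
    by (rule general_positionD(1)[OF gp]) (use that N \<open>v \<in> V\<close> in blast)+
  have gp2: "cross (p v - p a) (q l) \<noteq> 0" if "a \<in> nbrs E v" "l \<in> K" for a l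
    by (rule general_positionD(2)[OF gp]) (use that N K \<open>v \<in> V\<close> in blast)+
  have gp3: "cross (q l) (q m) \<noteq> 0" if "l \<in> K" "m \<in> K" "l \<noteq> m" for l m
    by (rule general_positionD(3)[OF gp]) (use that K in blast)+
  have gp4: "p v \<noteq> p a" if "a \<in> nbrs E v" for a
    by (rule general_positionD(4)[OF gp]) (use that N \<open>v \<in> V\<close> in blast)+
  have gp5: "q l \<noteq> 0" if "l \<in> K" for l
    by (rule general_positionD(5)[OF gp]) (use that K in blast)
  have cN: "card (nbrs E v) \<le> 2" and cK: "card K \<le> 2" using deg by auto
  have "(\<forall>u\<in>nbrs E v. \<omega> {u, v} = 0) \<and> (\<forall>l\<in>K. \<mu> l = 0)"
  proof (cases rule: card_le_2_cases[OF fin(1) cN])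
    case 1
    show ?thesis
    proof (cases rule: card_le_2_cases[OF fin(2) cK])
      case (3 l m)
      then show ?thesis
        using 1 0 cross_nonzero_independent[OF gp3[of l m], of "\<mu> l" "\<mu> m"] by simp
    qed (use 1 0 gp5 in auto)
  next
    case (2 a)
    then have "card K \<le> 1" using deg by simp
    then show ?thesis
    proof (cases rule: card_le_2_cases[OF fin(2) cK])
      case (2 l)
      then show ?thesis
        using \<open>nbrs E v = {a}\<close> 0 cross_nonzero_independent[OF gp2[of a l], of "\<omega> {a, v}" "\<mu> l"] by simp
    qed (use 2 0 gp4 in auto)
  next
    case (3 a b)
    then have "K = {}" using deg fin(2) by simp
    then show ?thesis
      using 3 0 cross_nonzero_independent[OF gp1[of a b], of "\<omega> {a, v}" "\<omega> {b, v}"] by simp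
  qed
  then show "(\<forall>u\<in>nbrs E v. \<omega> {u, v} = 0) \<and> (\<forall>l\<in>M. lv l = v \<longrightarrow> \<mu> l = 0)"
    by (simp add: K_def)
qed

text \<open>With \<open>v\<close> placed at \<open>p a + q l\<close>, the rows of the edge \<open>av\<close> and of the loop \<open>l\<close> at \<open>v\<close>
  combine to the row of \<open>l\<close> moved to \<open>a\<close>.\<close>

lemma stress_free_1_extension_loop:
  assumes E: "finite E" "\<forall>e\<in>E. e \<subseteq> V \<and> card e = 2" and M: "finite M" "M \<subseteq> L"
    and gp: "general_position V L p q"
    and sf: "stress_free p q (lv(l := a)) {e \<in> E. v \<notin> e} (insert l {l \<in> M. lv l \<noteq> v})"
    and a: "a \<in> nbrs E v" and l: "l \<in> M" "lv l = v"
    and deg: "card (nbrs E v) + card {l \<in> M. lv l = v} = 3"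
  shows "stress_free (p(v := p a + q l)) q lv E M"
proof (rule stress_freeI_vertex[OF E(1)])
  let ?p = "p(v := p a + q l)"
  let ?E = "{e \<in> E. v \<notin> e}" and ?M = "{l \<in> M. lv l \<noteq> v}"
  show E2: "\<forall>e\<in>E. card e = 2" using E(2) by blast
  fix \<omega> \<mu> assume 0: "\<And>w. stress_at ?p q lv E M \<omega> \<mu> w = 0"
  define K where "K = {l \<in> M. lv l = v}"
  have N: "nbrs E v \<subseteq> V - {v}" using E(2) self_notin_nbrs[OF E2] by (auto simp: nbrs_def)
  have K: "K \<subseteq> L" "l \<in> K" using M(2) l by (auto simp: K_def)
  have fin: "finite (nbrs E v)" "finite K" using finite_nbrs[OF E(1) E2] M(1) by (auto simp: K_def)
  have stress_v: "(\<Sum>u\<in>nbrs E v. \<omega> {u, v} *\<^sub>R (?p v - ?p u)) + (\<Sum>l\<in>K. \<mu> l *\<^sub>R q l) = 0"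
    using 0[of v] by (simp only: stress_at_def K_def)
  have "card (nbrs E v - {a}) + card (K - {l}) = 1"
    using deg card.remove[OF fin(1) a] card.remove[OF fin(2) K(2)] unfolding K_def by linarith
  then consider b where "nbrs E v - {a} = {b}" "K - {l} = {}" | m where "nbrs E v - {a} = {}" "K - {l} = {m}"
  proof -
    assume "card (nbrs E v - {a}) + card (K - {l}) = 1"
    then have "card (nbrs E v - {a}) = 1 \<and> card (K - {l}) = 0 \<or> card (nbrs E v - {a}) = 0 \<and> card (K - {l}) = 1"
      by linarith
    then show thesis
    proof
      assume *: "card (nbrs E v - {a}) = 1 \<and> card (K - {l}) = 0"
      then obtain b where "nbrs E v - {a} = {b}" using card_1_singleton_iff by (metis One_nat_def)
      then show thesis using * fin by (intro that(1)) simp_all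
    next
      assume *: "card (nbrs E v - {a}) = 0 \<and> card (K - {l}) = 1"
      then obtain m where "K - {l} = {m}" using card_1_singleton_iff by (metis One_nat_def)
      then show thesis using * fin by (intro that(2)) simp_all
    qed
  qed
  \<comment> \<open>Three vectors act at \<open>v\<close>: \<open>q l\<close> twice, from the edge
    to \<open>a\<close> and from the loop, and one that is independent of
    \<open>q l\<close>.\<close>
  then have at_v: "\<omega> {a, v} + \<mu> l = 0 \<and> (\<forall>u\<in>nbrs E v - {a}. \<omega> {u, v} = 0) \<and> (\<forall>m\<in>K - {l}. \<mu> m = 0)"
  proof cases
    case (1 b)
    then have N': "nbrs E v = {a, b}" "a \<noteq> b" and K': "K = {l}" using a K(2) by blast+
    then have "a \<noteq> v" "b \<noteq> v" using N by blast+
    then have "(\<omega> {a, v} + \<mu> l) *\<^sub>R q l + \<omega> {b, v} *\<^sub>R (p a - p b + q l) = 0"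
      using stress_v N'(2) unfolding N'(1) K' by (simp add: algebra_simps)
    moreover have "cross (p a - p b) (q l) \<noteq> 0"
      by (rule general_positionD(2)[OF gp]) (use N N' K in blast)+
    then have "cross (q l) (p a - p b + q l) \<noteq> 0"
      using cross_commute[of "q l"] by (simp add: cross_add)
    ultimately show ?thesis
      using cross_nonzero_independent(1)[of "q l" _ "\<omega> {a, v} + \<mu> l"]
        cross_nonzero_independent(2)[of "q l" _ "\<omega> {a, v} + \<mu> l"] unfolding 1 by blast
  next
    case (2 m)
    then have N': "nbrs E v = {a}" and K': "K = {l, m}" "l \<noteq> m" using a K(2) by blast+
    then have "a \<noteq> v" using N by blast
    then have "(\<omega> {a, v} + \<mu> l) *\<^sub>R q l + \<mu> m *\<^sub>R q m = 0"
      using stress_v K'(2) unfolding N' K'(1) by (simp add: algebra_simps)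
    moreover have "cross (q l) (q m) \<noteq> 0"
      by (rule general_positionD(3)[OF gp]) (use K K' in blast)+
    ultimately show ?thesis
      using cross_nonzero_independent(1)[of "q l" _ "\<omega> {a, v} + \<mu> l"]
        cross_nonzero_independent(2)[of "q l" _ "\<omega> {a, v} + \<mu> l"] unfolding 2 by blast
  qed
  \<comment> \<open>By \<open>at_v\<close>, the term of the edge \<open>av\<close> at
    \<open>a\<close> equals that of the loop \<open>l\<close> once moved to \<open>a\<close>, so the
    stress carries over with the same coefficients.\<close>
  have "stress_at p q (lv(l := a)) ?E (insert l ?M) \<omega> \<mu> w = 0" for w
  proof (cases "w = v")
    case True
    have "{m \<in> insert l ?M. (lv(l := a)) m = v} = {}" using N a by auto
    moreover have "nbrs ?E v = {}" by (auto simp: nbrs_def)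
    ultimately show ?thesis unfolding True stress_at_def by (simp only: sum.empty add_0)
  next
    case False
    have "{m \<in> insert l ?M. (lv(l := a)) m = w} =
        (if w = a then insert l {m \<in> ?M. lv m = w} else {m \<in> ?M. lv m = w})"
      using l by auto
    then have "(\<Sum>m\<in>{m \<in> insert l ?M. (lv(l := a)) m = w}. \<mu> m *\<^sub>R q m) =
        (\<Sum>m\<in>{m \<in> ?M. lv m = w}. \<mu> m *\<^sub>R q m) + (if w = a then \<mu> l *\<^sub>R q l else 0)"
      using l M(1) by simp
    then have "stress_at p q (lv(l := a)) ?E (insert l ?M) \<omega> \<mu> w =
        stress_at p q lv ?E ?M \<omega> \<mu> w + (if w = a then \<mu> l *\<^sub>R q l else 0)"
      by (simp add: stress_at_def)
    also have "\<dots> = stress_at ?p q lv ?E ?M \<omega> \<mu> w +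
        (if w \<in> nbrs E v then \<omega> {w, v} *\<^sub>R (?p w - ?p v) else 0)"
    proof -
      have \<mu>: "\<mu> l = - \<omega> {a, v}" using at_v by simp
      then have "(if w = a then \<mu> l *\<^sub>R q l else 0) =
          (if w \<in> nbrs E v then \<omega> {w, v} *\<^sub>R (?p w - ?p v) else 0)"
        using False a at_v by (auto simp: \<mu>)
      then show ?thesis by (simp only: stress_at_upd_removed[OF False])
    qed
    also have "\<dots> = stress_at ?p q lv E M \<omega> \<mu> w"
      by (rule stress_at_remove_vertex[OF E(1) E2 False, symmetric])
    finally show ?thesis using 0 by simp
  qed
  then have "(\<forall>e\<in>?E. \<omega> e = 0) \<and> (\<forall>l\<in>insert l ?M. \<mu> l = 0)"
    using sf unfolding stress_free_def by blast
  then show "(\<forall>e\<in>E. v \<notin> e \<longrightarrow> \<omega> e = 0) \<and> (\<forall>l\<in>M. lv l \<noteq> v \<longrightarrow> \<mu> l = 0) \<and>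
      (\<forall>u\<in>nbrs E v. \<omega> {u, v} = 0) \<and> (\<forall>l\<in>M. lv l = v \<longrightarrow> \<mu> l = 0)"
    using at_v by (auto simp: K_def)
qed

text \<open>With \<open>v\<close> placed at the midpoint of \<open>p a\<close> and \<open>p b\<close>, the rows of the edges \<open>av\<close> and \<open>bv\<close>
  combine to a multiple of the row of the edge \<open>ab\<close>.\<close>

lemma stress_free_1_extension_edge:
  assumes E: "finite E" "\<forall>e\<in>E. e \<subseteq> V \<and> card e = 2"
    and gp: "general_position V L p q"
    and sf: "stress_free p q lv (insert {a, b} {e \<in> E. v \<notin> e}) M"
    and new: "{a, b} \<notin> E"
    and N: "nbrs E v = {a, b, c}" "a \<noteq> b" "a \<noteq> c" "b \<noteq> c" and no_loop: "\<forall>l\<in>M. lv l \<noteq> v"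
  shows "stress_free (p(v := (1/2) *\<^sub>R (p a + p b))) q lv E M"
proof (rule stress_freeI_vertex[OF E(1)])
  let ?p = "p(v := (1/2) *\<^sub>R (p a + p b))"
  let ?E = "{e \<in> E. v \<notin> e}"
  show E2: "\<forall>e\<in>E. card e = 2" using E(2) by blast
  fix \<omega> \<mu> assume 0: "\<And>w. stress_at ?p q lv E M \<omega> \<mu> w = 0"
  have M: "{l \<in> M. lv l \<noteq> v} = M" "{l \<in> M. lv l = v} = {}" using no_loop by auto
  have abc: "a \<in> V - {v}" "b \<in> V - {v}" "c \<in> V - {v}"
  proof -
    have "nbrs E v \<subseteq> V - {v}" using E(2) self_notin_nbrs[OF E2] by (auto simp: nbrs_def)
    then show "a \<in> V - {v}" "b \<in> V - {v}" "c \<in> V - {v}" using N(1) by blast+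
  qed
  let ?x = "\<omega> {a, v}" and ?y = "\<omega> {b, v}" and ?z = "\<omega> {c, v}"
  have "stress_at ?p q lv E M \<omega> \<mu> v = ?x *\<^sub>R (?p v - p a) + ?y *\<^sub>R (?p v - p b) + ?z *\<^sub>R (?p v - p c)"
    unfolding stress_at_def N(1) M using N abc by simp
  \<comment> \<open>Seen from the midpoint, \<open>a\<close> and \<open>b\<close> lie in opposite
    directions at equal distance, so only the difference of their coefficients matters.\<close>
  also have "\<dots> = ((?y - ?x) / 2) *\<^sub>R (p a - p b) + ?z *\<^sub>R ((p a - p c) - (1/2) *\<^sub>R (p a - p b))"
    by (vector field_simps)
  finally have "((?y - ?x) / 2) *\<^sub>R (p a - p b) + ?z *\<^sub>R ((p a - p c) - (1/2) *\<^sub>R (p a - p b)) = 0"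
    using 0 by simp
  moreover have "cross (p a - p b) (p a - p c) \<noteq> 0"
    by (rule general_positionD(1)[OF gp]) (use N abc in blast)+
  then have "cross (p a - p b) ((p a - p c) - (1/2) *\<^sub>R (p a - p b)) \<noteq> 0"
    using cross_diff(2)[of "p a - p b" "p a - p c"] by simp
  ultimately have "(?y - ?x) / 2 = 0" "?z = 0" using cross_nonzero_independent by blast+
  then have xy: "?y = ?x" and z: "?z = 0" by simp_all
  \<comment> \<open>The segment from \<open>a\<close> to the midpoint is half of \<open>ab\<close>,
    hence the factor 1/2.\<close>
  define \<omega>' where "\<omega>' = \<omega>({a, b} := ?x / 2)"
  have "stress_at p q lv (insert {a, b} ?E) M \<omega>' \<mu> w = 0" for w
  proof (cases "w = v")
    case True
    have "nbrs (insert {a, b} ?E) v = {}" using abc by (auto simp: nbrs_def doubleton_eq_iff)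
    then show ?thesis unfolding True stress_at_def M by simp
  next
    case False
    let ?t = "if w = a then (?x / 2) *\<^sub>R (p a - p b) else if w = b then (?x / 2) *\<^sub>R (p b - p a) else 0"
    have fin: "finite (nbrs ?E w)" using E(1) E2 by (intro finite_nbrs) auto
    have nb: "nbrs (insert {a, b} ?E) w =
        (if w = a then insert b (nbrs ?E w) else if w = b then insert a (nbrs ?E w) else nbrs ?E w)"
    proof -
      have "nbrs (insert {a, b} ?E) w = {u. {u, w} = {a, b}} \<union> nbrs ?E w" unfolding nbrs_def by blast
      moreover have "{u. {u, w} = {a, b}} = (if w = a then {b} else if w = b then {a} else {})"
        using N(2) by (auto simp: doubleton_eq_iff)
      ultimately show ?thesis by simp
    qed
    have notin: "b \<notin> nbrs ?E a" "a \<notin> nbrs ?E b"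
      using new doubleton_eq_iff[of a b b a] unfolding nbrs_def by auto
    have ne: "{u, w} \<noteq> {a, b}" if "u \<in> nbrs ?E w" for u
    proof -
      have "{u, w} \<in> E" using that unfolding nbrs_def by blast
      then show ?thesis using new by metis
    qed
    have same: "(\<Sum>u\<in>nbrs ?E w. \<omega>' {u, w} *\<^sub>R (p w - p u)) = (\<Sum>u\<in>nbrs ?E w. \<omega> {u, w} *\<^sub>R (p w - p u))"
      by (intro sum.cong refl) (simp add: \<omega>'_def ne)
    have "stress_at p q lv (insert {a, b} ?E) M \<omega>' \<mu> w = stress_at p q lv ?E M \<omega> \<mu> w + ?t"
    proof -
      consider "w = a" | "w = b" "w \<noteq> a" | "w \<noteq> a" "w \<noteq> b" by blast
      then show ?thesis
      proof cases
        case 1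
        then show ?thesis
          using N(2) notin fin same unfolding stress_at_def nb
          by (simp add: \<omega>'_def insert_commute[of b a])
      next
        case 2
        then show ?thesis
          using N(2) notin fin same unfolding stress_at_def nb by (simp add: \<omega>'_def)
      next
        case 3
        then show ?thesis using same unfolding stress_at_def nb by simp
      qed
    qed
    also have "\<dots> = stress_at ?p q lv ?E M \<omega> \<mu> w +
        (if w \<in> nbrs E v then \<omega> {w, v} *\<^sub>R (?p w - ?p v) else 0)"
    proof -
      have "(?x / 2) *\<^sub>R (p a - p b) = ?x *\<^sub>R (p a - ?p v)" "(?x / 2) *\<^sub>R (p b - p a) = ?x *\<^sub>R (p b - ?p v)"
        by (vector field_simps)+
      then have "?t = (if w \<in> nbrs E v then \<omega> {w, v} *\<^sub>R (?p w - ?p v) else 0)"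
        using False N abc xy z by auto
      then show ?thesis by (simp only: stress_at_upd_removed[OF False])
    qed
    also have "\<dots> = stress_at ?p q lv E M \<omega> \<mu> w"
      using stress_at_remove_vertex[OF E(1) E2 False, of ?p q lv M \<omega> \<mu>] unfolding M(1) by simp
    finally show ?thesis using 0 by simp
  qed
  then have "\<forall>e\<in>insert {a, b} ?E. \<omega>' e = 0" "\<forall>l\<in>M. \<mu> l = 0"
    using sf unfolding stress_free_def by blast+
  then have "?x = 0" "\<forall>e\<in>?E. \<omega> e = 0" "\<forall>l\<in>M. \<mu> l = 0"
    using new by (auto simp: \<omega>'_def split: if_splits)
  then show "(\<forall>e\<in>E. v \<notin> e \<longrightarrow> \<omega> e = 0) \<and> (\<forall>l\<in>M. lv l \<noteq> v \<longrightarrow> \<mu> l = 0) \<and>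
      (\<forall>u\<in>nbrs E v. \<omega> {u, v} = 0) \<and> (\<forall>l\<in>M. lv l = v \<longrightarrow> \<mu> l = 0)"
    using xy z unfolding N(1) by simp
qed

section \<open>Sparse sets\<close>

definition induced :: "'v set set \<Rightarrow> 'v set \<Rightarrow> 'v set set" where
  "induced E X = {e \<in> E. e \<subseteq> X}"

definition loops_at :: "('l \<Rightarrow> 'v) \<Rightarrow> 'l set \<Rightarrow> 'v set \<Rightarrow> 'l set" where
  "loops_at lv L X = {l \<in> L. lv l \<in> X}"

text \<open>The 3 stands on the left to avoid truncated subtraction. Quantifying over all finite
  sets spares a vertex set parameter; \<open>tight_subset\<close> later locates the tight
  sets.\<close>

definition sparse :: "('l \<Rightarrow> 'v) \<Rightarrow> 'v set set \<Rightarrow> 'l set \<Rightarrow> bool" where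
  "sparse lv E L \<longleftrightarrow> finite E \<and> finite L \<and> (\<forall>e\<in>E. card e = 2) \<and>
     (\<forall>X. finite X \<longrightarrow> card (induced E X) + card (loops_at lv L X) \<le> 2 * card X \<and>
       (2 \<le> card X \<longrightarrow> card (induced E X) + 3 \<le> 2 * card X))"

definition full_tight :: "('l \<Rightarrow> 'v) \<Rightarrow> 'v set set \<Rightarrow> 'l set \<Rightarrow> 'v set \<Rightarrow> bool" where
  "full_tight lv E L Y \<longleftrightarrow> finite Y \<and> card (induced E Y) + card (loops_at lv L Y) = 2 * card Y"

definition edge_tight :: "'v set set \<Rightarrow> 'v set \<Rightarrow> bool" where
  "edge_tight E X \<longleftrightarrow> finite X \<and> 2 \<le> card X \<and> card (induced E X) + 3 = 2 * card X"

lemma finite_induced [simp]: "finite E \<Longrightarrow> finite (induced E X)"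
  by (simp add: induced_def)

lemma finite_loops_at [simp]: "finite L \<Longrightarrow> finite (loops_at lv L X)"
  by (simp add: loops_at_def)

lemma sparseD:
  assumes "sparse lv E L"
  shows "finite E" "finite L" "\<forall>e\<in>E. card e = 2"
    and "finite X \<Longrightarrow> card (induced E X) + card (loops_at lv L X) \<le> 2 * card X"
    and "finite X \<Longrightarrow> 2 \<le> card X \<Longrightarrow> card (induced E X) + 3 \<le> 2 * card X"
  using assms by (auto simp: sparse_def)

lemma card_induced_supermodular:
  assumes "finite E"
  shows "card (induced E X) + card (induced E Y) \<le> card (induced E (X \<union> Y)) + card (induced E (X \<inter> Y))"
proof -
  have "card (induced E X) + card (induced E Y) =
      card (induced E X \<union> induced E Y) + card (induced E X \<inter> induced E Y)"
    using assms by (intro card_Un_Int) auto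
  moreover have "card (induced E X \<union> induced E Y) \<le> card (induced E (X \<union> Y))"
    using assms by (intro card_mono) (auto simp: induced_def)
  moreover have "induced E X \<inter> induced E Y = induced E (X \<inter> Y)"
    by (auto simp: induced_def)
  ultimately show ?thesis by simp
qed

lemma card_loops_at_modular:
  assumes "finite L"
  shows "card (loops_at lv L X) + card (loops_at lv L Y) =
    card (loops_at lv L (X \<union> Y)) + card (loops_at lv L (X \<inter> Y))"
proof -
  have "loops_at lv L (X \<union> Y) = loops_at lv L X \<union> loops_at lv L Y"
    "loops_at lv L (X \<inter> Y) = loops_at lv L X \<inter> loops_at lv L Y"
    by (auto simp: loops_at_def)
  then show ?thesis using assms card_Un_Int[of "loops_at lv L X" "loops_at lv L Y"] by simp
qed

text \<open>The element count is supermodular and the bound 2|X| is modular. The bound also holds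
  for an empty intersection, so the two sets need not meet.\<close>

lemma full_tight_Un:
  assumes s: "sparse lv E L" and X: "full_tight lv E L X" and Y: "full_tight lv E L Y"
  shows "full_tight lv E L (X \<union> Y)"
proof -
  have fin: "finite X" "finite Y" using X Y by (auto simp: full_tight_def)
  have "card (induced E (X \<union> Y)) + card (loops_at lv L (X \<union> Y)) \<le> 2 * card (X \<union> Y)"
    "card (induced E (X \<inter> Y)) + card (loops_at lv L (X \<inter> Y)) \<le> 2 * card (X \<inter> Y)"
    using fin by (auto intro!: sparseD[OF s])
  then have "card (induced E (X \<union> Y)) + card (loops_at lv L (X \<union> Y)) = 2 * card (X \<union> Y)"
    using X Y card_induced_supermodular[OF sparseD(1)[OF s], of X Y]
      card_loops_at_modular[OF sparseD(2)[OF s], of lv X Y] card_Un_Int[OF fin]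
    unfolding full_tight_def by linarith
  then show ?thesis using fin by (simp add: full_tight_def)
qed

lemma full_tight_Union:
  assumes s: "sparse lv E L" and "finite \<Y>" "\<forall>Y\<in>\<Y>. full_tight lv E L Y"
  shows "full_tight lv E L (\<Union>\<Y>)"
  using assms(2,3)
proof (induction \<Y> rule: finite_induct)
  case empty
  have "{} \<notin> E" using sparseD(3)[OF s] by auto
  then have "induced E {} = {}" "loops_at lv L {} = {}" by (auto simp: induced_def loops_at_def)
  then show ?case by (simp add: full_tight_def)
next
  case (insert Y \<Y>)
  then show ?case using full_tight_Un[OF s, of Y "\<Union>\<Y>"] by simp
qed

text \<open>Same uncrossing; two common vertices are required for the edge bound to apply to the
  intersection.\<close>

lemma edge_tight_Un:
  assumes s: "sparse lv E L" and X: "edge_tight E X" and Y: "edge_tight E Y"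
    and int: "2 \<le> card (X \<inter> Y)"
  shows "edge_tight E (X \<union> Y)"
proof -
  have fin: "finite X" "finite Y" using X Y by (auto simp: edge_tight_def)
  have 2: "2 \<le> card (X \<union> Y)"
    using X fin card_mono[of "X \<union> Y" X] unfolding edge_tight_def by auto
  have "card (induced E (X \<union> Y)) + 3 \<le> 2 * card (X \<union> Y)"
    "card (induced E (X \<inter> Y)) + 3 \<le> 2 * card (X \<inter> Y)"
    using fin int 2 by (auto intro!: sparseD(5)[OF s])
  then have "card (induced E (X \<union> Y)) + 3 = 2 * card (X \<union> Y)"
    using X Y card_induced_supermodular[OF sparseD(1)[OF s], of X Y] card_Un_Int[OF fin]
    unfolding edge_tight_def by linarith
  then show ?thesis using fin 2 by (simp add: edge_tight_def)
qed

text \<open>The 3 missing in \<open>Y\<close> is compensated by the 3 in the edge bound for the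
  intersection. Loops enter only through monotonicity.\<close>

lemma full_tight_Un_edge_tight:
  assumes s: "sparse lv E L" and X: "full_tight lv E L X" and Y: "edge_tight E Y"
    and int: "2 \<le> card (X \<inter> Y)"
  shows "full_tight lv E L (X \<union> Y)"
proof -
  have fin: "finite X" "finite Y" using X Y by (auto simp: full_tight_def edge_tight_def)
  have "card (induced E (X \<union> Y)) + card (loops_at lv L (X \<union> Y)) \<le> 2 * card (X \<union> Y)"
    "card (induced E (X \<inter> Y)) + 3 \<le> 2 * card (X \<inter> Y)"
    using fin int by (auto intro!: sparseD(4,5)[OF s])
  moreover have "card (loops_at lv L X) \<le> card (loops_at lv L (X \<union> Y))"
    using sparseD(2)[OF s] by (intro card_mono) (auto simp: loops_at_def)
  ultimately have "card (induced E (X \<union> Y)) + card (loops_at lv L (X \<union> Y)) = 2 * card (X \<union> Y)"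
    using X Y card_induced_supermodular[OF sparseD(1)[OF s], of X Y] card_Un_Int[OF fin]
    unfolding full_tight_def edge_tight_def by linarith
  then show ?thesis using fin by (simp add: full_tight_def)
qed

text \<open>The obstructions to a new edge: inside such a set it would exceed one of the two bounds
  of \<open>sparse\<close>.\<close>

definition tight :: "('l \<Rightarrow> 'v) \<Rightarrow> 'v set set \<Rightarrow> 'l set \<Rightarrow> 'v set \<Rightarrow> bool" where
  "tight lv E L X \<longleftrightarrow> full_tight lv E L X \<or> edge_tight E X"

lemma tight_finite: "tight lv E L X \<Longrightarrow> finite X"
  by (auto simp: tight_def full_tight_def edge_tight_def)

lemma tight_Un:
  assumes "sparse lv E L" "tight lv E L X" "tight lv E L Y" "2 \<le> card (X \<inter> Y)"
  shows "tight lv E L (X \<union> Y)"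
  using assms full_tight_Un[of lv E L X Y] edge_tight_Un[of lv E L X Y]
    full_tight_Un_edge_tight[of lv E L X Y] full_tight_Un_edge_tight[of lv E L Y X]
  unfolding tight_def by (metis Int_commute Un_commute)

lemma card_induced_three:
  assumes fin: "finite E" "finite A" "finite B" "finite C" and E: "\<forall>e\<in>E. card e = 2"
    and int: "A \<inter> B = {a}" "A \<inter> C = {b}" "B \<inter> C = {c}" and "b \<noteq> c"
  shows "card (A \<union> B \<union> C) + 3 = card A + card B + card C"
    and "card (induced E A) + card (induced E B) + card (induced E C) \<le> card (induced E (A \<union> B \<union> C))"
proof -
  have "(A \<union> B) \<inter> C = {b, c}" using int by blast
  then show "card (A \<union> B \<union> C) + 3 = card A + card B + card C"
    using card_Un_Int[OF fin(2,3)] card_Un_Int[of "A \<union> B" C] fin int(1) \<open>b \<noteq> c\<close> by simp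
  have disj: "induced E X \<inter> induced E Y = {}" if "X \<inter> Y = {x}" for X Y x
  proof -
    have "card e \<le> 1" if "e \<in> induced E X \<inter> induced E Y" for e
    proof -
      have "e \<subseteq> {x}" using that \<open>X \<inter> Y = {x}\<close> by (auto simp: induced_def)
      then show ?thesis using card_mono[of "{x}" e] by simp
    qed
    then show ?thesis using E by (fastforce simp: induced_def)
  qed
  have "card (induced E A) + card (induced E B) + card (induced E C) =
      card (induced E A \<union> induced E B \<union> induced E C)"
    using fin disj[OF int(1)] disj[OF int(2)] disj[OF int(3)]
    by (subst card_Un_disjoint; (subst card_Un_disjoint)?) auto
  also have "\<dots> \<le> card (induced E (A \<union> B \<union> C))"
    using fin(1) by (intro card_mono) (auto simp: induced_def)
  finally show "card (induced E A) + card (induced E B) + card (induced E C) \<le> card (induced E (A \<union> B \<union> C))" .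
qed

text \<open>If no union of two of the sets is tight, they meet pairwise in single vertices and at
  most one is fully tight. The union U then has |U| = |A| + |B| + |C| - 3. Three edge-tight sets
  contribute 2(|U| + 3) - 9 = 2|U| - 3 edges; with one fully tight set there are 2(|U| + 3) - 6 =
  2|U| elements. Either way U is tight.\<close>

lemma tight_three:
  assumes s: "sparse lv E L" and tight: "tight lv E L A" "tight lv E L B" "tight lv E L C"
    and mem: "a \<in> A \<inter> B" "b \<in> A \<inter> C" "c \<in> B \<inter> C" and ne: "a \<noteq> b" "a \<noteq> c" "b \<noteq> c"
  shows "\<exists>T. tight lv E L T \<and> {a, b, c} \<subseteq> T"
proof (rule ccontr)
  assume no: "\<not> ?thesis"
  have fin: "finite A" "finite B" "finite C" using tight tight_finite by blast+
  have single: "X \<inter> Y = {x}" if "tight lv E L X" "tight lv E L Y" "{a, b, c} \<subseteq> X \<union> Y" "x \<in> X \<inter> Y" for X Y x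
  proof -
    have "\<not> 2 \<le> card (X \<inter> Y)" using no tight_Un[OF s that(1,2)] that(3) by blast
    moreover have "finite (X \<inter> Y)" using tight_finite[OF that(1)] by simp
    ultimately have "card (X \<inter> Y) \<le> card {x}" by simp
    then show ?thesis using card_seteq[of "X \<inter> Y" "{x}"] that(4) \<open>finite (X \<inter> Y)\<close> by blast
  qed
  have not_both: "\<not> (full_tight lv E L X \<and> full_tight lv E L Y)" if "{a, b, c} \<subseteq> X \<union> Y" for X Y
    using no full_tight_Un[OF s, of X Y] that unfolding tight_def by blast
  have int: "A \<inter> B = {a}" "A \<inter> C = {b}" "B \<inter> C = {c}"
    by (rule single[OF tight(1,2)] single[OF tight(1,3)] single[OF tight(2,3)]; use mem in blast)+
  let ?U = "A \<union> B \<union> C"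
  note three = card_induced_three[OF sparseD(1)[OF s] fin sparseD(3)[OF s] int ne(3)]
  have sub: "{a, b, c} \<subseteq> ?U" using mem by blast
  have U: "finite ?U" "\<not> tight lv E L ?U" using fin no sub by (simp, blast)
  have "card {a, b} \<le> card ?U" by (rule card_mono[OF U(1)]) (use sub in blast)
  then have U2: "2 \<le> card ?U" using ne by simp
  have "card (loops_at lv L A) \<le> card (loops_at lv L ?U)" "card (loops_at lv L B) \<le> card (loops_at lv L ?U)"
      "card (loops_at lv L C) \<le> card (loops_at lv L ?U)"
    using sparseD(2)[OF s] by (auto intro!: card_mono simp: loops_at_def)
  moreover have "card (induced E ?U) + card (loops_at lv L ?U) < 2 * card ?U"
    "card (induced E ?U) + 3 < 2 * card ?U"
    using U U2 sparseD(4,5)[OF s U(1)] unfolding tight_def full_tight_def edge_tight_def by linarith+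
  moreover have "\<not> (full_tight lv E L A \<and> full_tight lv E L B)"
      "\<not> (full_tight lv E L A \<and> full_tight lv E L C)" "\<not> (full_tight lv E L B \<and> full_tight lv E L C)"
    by (rule not_both; use mem in blast)+
  ultimately show False
    using tight three unfolding tight_def full_tight_def edge_tight_def by linarith
qed

section \<open>Insertions that preserve sparsity, and vertices of low degree\<close>

lemma sparse_subset:
  assumes s: "sparse lv E L" and "E' \<subseteq> E" "L' \<subseteq> L"
  shows "sparse lv E' L'"
proof -
  have "card (induced E' X) \<le> card (induced E X)" "card (loops_at lv L' X) \<le> card (loops_at lv L X)" for X
    using assms sparseD(1,2)[OF s] by (auto intro!: card_mono simp: induced_def loops_at_def)
  moreover have "finite E'" "finite L'" using assms sparseD(1,2)[OF s] finite_subset by blast+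
  ultimately show ?thesis
    using sparseD[OF s] assms(2) unfolding sparse_def by (meson add_mono le_trans order_refl subsetD)
qed

text \<open>A loop counts only in the first bound, so only a fully tight set can block it. The
  update of \<open>lv\<close> covers both moving a loop to \<open>a\<close> and, with
  \<open>a = lv l\<close>, inserting one where it already sits.\<close>

lemma sparse_insert_loop:
  assumes s: "sparse lv E L" and "l \<notin> L" and no: "\<And>Y. full_tight lv E L Y \<Longrightarrow> a \<notin> Y"
  shows "sparse (lv(l := a)) E (insert l L)"
proof -
  have "card (induced E X) + card (loops_at (lv(l := a)) (insert l L) X) \<le> 2 * card X" if "finite X" for X
  proof -
    have "loops_at (lv(l := a)) (insert l L) X = (if a \<in> X then insert l (loops_at lv L X) else loops_at lv L X)"
      using \<open>l \<notin> L\<close> by (auto simp: loops_at_def)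
    moreover have "l \<notin> loops_at lv L X" using \<open>l \<notin> L\<close> by (simp add: loops_at_def)
    moreover have "card (induced E X) + card (loops_at lv L X) \<noteq> 2 * card X" if "a \<in> X"
      using no[of X] that \<open>finite X\<close> by (auto simp: full_tight_def)
    ultimately show ?thesis
      using sparseD(2)[OF s] sparseD(4)[OF s \<open>finite X\<close>] by (cases "a \<in> X") auto
  qed
  then show ?thesis using sparseD[OF s] unfolding sparse_def by blast
qed

text \<open>An edge already present would make \<open>{a, b}\<close> edge-tight, since 1 = 2 * 2 -
  3; this is why the absence of a tight set also shows that the edge is new.\<close>

lemma sparse_insert_edge:
  assumes s: "sparse lv E L" and "a \<noteq> b" and no: "\<And>T. tight lv E L T \<Longrightarrow> \<not> {a, b} \<subseteq> T"
  shows "{a, b} \<notin> E" "sparse lv (insert {a, b} E) L"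
proof -
  show new: "{a, b} \<notin> E"
  proof
    assume "{a, b} \<in> E"
    then have "{a, b} \<in> induced E {a, b}" by (simp add: induced_def)
    then have "1 \<le> card (induced E {a, b})"
      using card_mono[of "induced E {a, b}" "{{a, b}}"] sparseD(1)[OF s] by simp
    then have "edge_tight E {a, b}"
      using sparseD(5)[OF s, of "{a, b}"] \<open>a \<noteq> b\<close> by (simp add: edge_tight_def)
    then show False using no by (auto simp: tight_def)
  qed
  have "card (induced (insert {a, b} E) X) + card (loops_at lv L X) \<le> 2 * card X \<and>
      (2 \<le> card X \<longrightarrow> card (induced (insert {a, b} E) X) + 3 \<le> 2 * card X)" if X: "finite X" for X
  proof -
    have "induced (insert {a, b} E) X = (if {a, b} \<subseteq> X then insert {a, b} (induced E X) else induced E X)"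
      by (auto simp: induced_def)
    moreover have "{a, b} \<notin> induced E X" using new by (simp add: induced_def)
    ultimately have card: "card (induced (insert {a, b} E) X) =
        (if {a, b} \<subseteq> X then card (induced E X) + 1 else card (induced E X))"
      using sparseD(1)[OF s] by simp
    show ?thesis
    proof (cases "{a, b} \<subseteq> X")
      case True
      then have "\<not> tight lv E L X" using no by blast
      then show ?thesis
        using True card X sparseD(4,5)[OF s X] unfolding tight_def full_tight_def edge_tight_def by auto
    next
      case False
      then show ?thesis using card sparseD(4,5)[OF s X] by auto
    qed
  qed
  then show "sparse lv (insert {a, b} E) L"
    using sparseD[OF s] \<open>a \<noteq> b\<close> unfolding sparse_def by simp
qed

lemma sum_degrees:
  assumes "finite E" "\<forall>e\<in>E. card e = 2" "finite W" "\<forall>e\<in>E. e \<subseteq> W"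
    and "finite M" "\<forall>l\<in>M. lv l \<in> W"
  shows "(\<Sum>w\<in>W. card (nbrs E w) + card {l \<in> M. lv l = w}) = 2 * card E + card M"
proof -
  have "(\<Sum>w\<in>W. card {e \<in> E. w \<in> e}) = 2 * card E"
  proof (rule sum_multicount[OF assms(3,1)], intro ballI)
    fix e assume e: "e \<in> E"
    then have "{w \<in> W. w \<in> e} = e" using assms(4) by blast
    then show "card {w \<in> W. w \<in> e} = 2" using assms(2) e by simp
  qed
  moreover have "(\<Sum>w\<in>W. card {l \<in> M. lv l = w}) = 1 * card M"
  proof (rule sum_multicount[OF assms(3,5)], intro ballI)
    fix l assume "l \<in> M"
    then have "{w \<in> W. lv l = w} = {lv l}" using assms(6) by blast
    then show "card {w \<in> W. lv l = w} = 1" by simp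
  qed
  ultimately show ?thesis by (simp add: sum.distrib card_nbrs[OF assms(2)])
qed

text \<open>With loops counted once, the degrees add up to |E| + (|E| + |M|) \<le> (2|W| - 3) + 2|W|
  < 4|W|. A single vertex carries no edge and is treated apart.\<close>

lemma sparse_low_degree_vertex:
  assumes s: "sparse lv E M" and W: "finite W" "W \<noteq> {}" "\<forall>e\<in>E. e \<subseteq> W" "\<forall>l\<in>M. lv l \<in> W"
  obtains v where "v \<in> W" "card (nbrs E v) + card {l \<in> M. lv l = v} \<le> 3"
proof -
  have "induced E W = E" "loops_at lv M W = M" using W by (auto simp: induced_def loops_at_def)
  then have EM: "card E + card M \<le> 2 * card W" "2 \<le> card W \<Longrightarrow> card E + 3 \<le> 2 * card W"
    using sparseD(4,5)[OF s W(1)] by auto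
  have W0: "0 < card W" using W by (simp add: card_gt_0_iff)
  have E0: "card E = 0" if "card W < 2"
  proof -
    have "card e \<le> card W" if "e \<in> E" for e using that W by (intro card_mono) auto
    then have "E = {}" using sparseD(3)[OF s] that by fastforce
    then show ?thesis by simp
  qed
  have "2 * card E + card M < 4 * card W"
    using EM E0 W0 by (cases "card W < 2") linarith+
  then have "(\<Sum>w\<in>W. card (nbrs E w) + card {l \<in> M. lv l = w}) < (\<Sum>w\<in>W. 4)"
    using sum_degrees[OF sparseD(1,3)[OF s] W(1,3) sparseD(2)[OF s] W(4)] by simp
  then have "\<exists>v\<in>W. \<not> 4 \<le> card (nbrs E v) + card {l \<in> M. lv l = v}"
    using sum_mono[of W "\<lambda>_. 4" "\<lambda>w. card (nbrs E w) + card {l \<in> M. lv l = w}"] by (meson not_le)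
  then show thesis using that by (auto simp: not_le)
qed

text \<open>Adding \<open>v\<close> to \<open>T\<close> would bring at least 3 elements but raise
  the bound by at most 2. Against the edge bound all 3 must be edges, hence the condition on
  loops.\<close>

lemma tight_not_superset_nbrs:
  assumes s: "sparse lv E M" and N: "nbrs E v \<subseteq> T"
    and deg: "3 \<le> card (nbrs E v) + card {l \<in> M. lv l = v}"
  shows "\<not> full_tight lv {e \<in> E. v \<notin> e} {l \<in> M. lv l \<noteq> v} T"
    and "{l \<in> M. lv l = v} = {} \<Longrightarrow> \<not> edge_tight {e \<in> E. v \<notin> e} T"
proof -
  let ?E = "{e \<in> E. v \<notin> e}" and ?M = "{l \<in> M. lv l \<noteq> v}"
  have E: "finite E" "\<forall>e\<in>E. card e = 2" and M: "finite M" using sparseD[OF s] by auto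
  have ve: "{e \<in> E. v \<in> e} = (\<lambda>u. {u, v}) ` nbrs E v"
    using bij_betw_imp_surj_on[OF bij_betw_nbrs[OF E(2)], of v] by simp
  have "card (induced ?E T) + card {e \<in> E. v \<in> e} = card (induced ?E T \<union> {e \<in> E. v \<in> e})"
    using E(1) by (intro card_Un_disjoint[symmetric]) (auto simp: induced_def)
  also have "\<dots> \<le> card (induced E (insert v T))"
    using E(1) N unfolding ve by (intro card_mono) (auto simp: induced_def nbrs_def)
  finally have 1: "card (induced ?E T) + card (nbrs E v) \<le> card (induced E (insert v T))"
    by (simp add: card_nbrs[OF E(2)])
  have "card (loops_at lv ?M T) + card {l \<in> M. lv l = v} = card (loops_at lv ?M T \<union> {l \<in> M. lv l = v})"
    using M by (intro card_Un_disjoint[symmetric]) (auto simp: loops_at_def)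
  also have "\<dots> \<le> card (loops_at lv M (insert v T))"
    using M by (intro card_mono) (auto simp: loops_at_def)
  finally have 2: "card (loops_at lv ?M T) + card {l \<in> M. lv l = v} \<le> card (loops_at lv M (insert v T))" .
  have 3: "finite T \<Longrightarrow> card (insert v T) \<le> card T + 1" by (simp add: card_insert_if)
  show "\<not> full_tight lv ?E ?M T"
  proof
    assume "full_tight lv ?E ?M T"
    then show False
      using 1 2 3 deg sparseD(4)[OF s, of "insert v T"] unfolding full_tight_def by simp
  qed
  show "\<not> edge_tight ?E T" if "{l \<in> M. lv l = v} = {}"
  proof
    assume T: "edge_tight ?E T"
    then have "2 \<le> card (insert v T)" using card_insert_le[of T v] by (simp add: edge_tight_def)
    moreover have "3 \<le> card (nbrs E v)" using deg by (simp add: that)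
    ultimately show False
      using T 1 3 sparseD(5)[OF s, of "insert v T"] unfolding edge_tight_def by simp
  qed
qed

text \<open>The graph and the loop positions vary in the induction, the placement does not. A moved
  loop keeps its name, hence its vector, so the loops remain among those of
  \<open>L\<close>.\<close>

theorem sparse_stress_free:
  fixes p :: "'v \<Rightarrow> real^2" and q :: "'l \<Rightarrow> real^2"
  assumes gen: "generic_on V L p q"
    and "finite W" "W \<subseteq> V" "\<forall>e\<in>E. e \<subseteq> W" "M \<subseteq> L" "\<forall>l\<in>M. lv l \<in> W" "sparse lv E M"
  shows "stress_free p q lv E M"
  using assms(2-)
proof (induction "card W" arbitrary: W E M lv rule: less_induct)
  case less
  note s = \<open>sparse lv E M\<close> and W = \<open>finite W\<close> \<open>W \<subseteq> V\<close> and EW = \<open>\<forall>e\<in>E. e \<subseteq> W\<close>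
    and Msub = \<open>M \<subseteq> L\<close> and MW = \<open>\<forall>l\<in>M. lv l \<in> W\<close>
  note gp = generic_on_general_position[OF gen]
  have E2: "\<forall>e\<in>E. card e = 2" and fin: "finite E" "finite M" using sparseD[OF s] by auto
  have EV: "\<forall>e\<in>E. e \<subseteq> V \<and> card e = 2" using EW W(2) E2 by blast
  have MV: "\<forall>l\<in>M. lv l \<in> V" using MW W(2) by blast
  show ?case
  proof (cases "W = {}")
    case True
    then have "E = {}" "M = {}" using EW E2 MW by fastforce+
    then show ?thesis by (simp add: stress_free_def)
  next
    case False
    obtain v where v: "v \<in> W" "card (nbrs E v) + card {l \<in> M. lv l = v} \<le> 3"
      using sparse_low_degree_vertex[OF s W(1) False EW MW] .
    define E' M' where "E' = {e \<in> E. v \<notin> e}" and "M' = {l \<in> M. lv l \<noteq> v}"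
    define N K where "N = nbrs E v" and "K = {l \<in> M. lv l = v}"
    have IH: "stress_free p q lv' F M''"
      if "\<forall>e\<in>F. e \<subseteq> W - {v}" "M'' \<subseteq> L" "\<forall>l\<in>M''. lv' l \<in> W - {v}" "sparse lv' F M''" for lv' F M''
      by (rule less.hyps[of "W - {v}"])
        (use that card_Diff1_less[OF W(1) v(1)] W in \<open>auto simp del: card_Diff_insert\<close>)
    have E'W: "\<forall>e\<in>E'. e \<subseteq> W - {v}" and M'W: "\<forall>l\<in>M'. lv l \<in> W - {v}" and M'L: "M' \<subseteq> L"
      using EW MW Msub by (auto simp: E'_def M'_def)
    have s': "sparse lv E' M'"
      using s by (rule sparse_subset) (auto simp: E'_def M'_def)
    have vV: "v \<in> V" using v(1) W(2) by blast
    have NW: "N \<subseteq> W - {v}" using EW self_notin_nbrs[OF E2, of v] by (auto simp: N_def nbrs_def)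
    have finN: "finite N" using NW W(1) finite_subset by blast
    have deg: "card N + card K \<le> 3" using v(2) by (simp only: N_def K_def)
    show ?thesis
    proof (cases "card N + card K \<le> 2")
      case True
      have "stress_free p q lv E' M'" using IH E'W M'L M'W s' by blast
      then show ?thesis
        using stress_free_0_extension[OF fin(1) EV fin(2) Msub gp vV] True
        unfolding E'_def M'_def N_def K_def by blast
    next
      case False
      then have deg3: "card N + card K = 3" using deg by simp
      show ?thesis
      proof (cases "K = {}")
        case False
        then obtain l where l: "l \<in> K" by blast
        have K2: "card K \<le> 2"
        proof -
          have "loops_at lv M {v} = K" by (auto simp: loops_at_def K_def)
          then show ?thesis using sparseD(4)[OF s, of "{v}"] by simp
        qed
        \<comment> \<open>Otherwise each neighbour lies in a fully tight set, and the union of these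
          sets is fully tight and contains all neighbours.\<close>
        have "\<exists>a\<in>N. \<forall>Y. full_tight lv E' M' Y \<longrightarrow> a \<notin> Y"
        proof (rule ccontr)
          assume "\<not> ?thesis"
          then obtain Y where Y: "\<And>a. a \<in> N \<Longrightarrow> full_tight lv E' M' (Y a) \<and> a \<in> Y a" by metis
          then have "full_tight lv E' M' (\<Union>(Y ` N))"
            using finN by (intro full_tight_Union[OF s']) auto
          moreover have "N \<subseteq> \<Union>(Y ` N)" using Y by blast
          ultimately show False
            using tight_not_superset_nbrs(1)[OF s, of v "\<Union>(Y ` N)"] deg3
            unfolding E'_def M'_def N_def K_def by simp
        qed
        then obtain a where a: "a \<in> N" "\<And>Y. full_tight lv E' M' Y \<Longrightarrow> a \<notin> Y" by blast
        have lM: "l \<in> M" "lv l = v" "l \<notin> M'" using l by (auto simp: K_def M'_def)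
        have "stress_free p q (lv(l := a)) E' (insert l M')"
        proof (rule IH[OF E'W])
          show "sparse (lv(l := a)) E' (insert l M')"
            using sparse_insert_loop[OF s' lM(3) a(2)] .
          show "\<forall>m\<in>insert l M'. (lv(l := a)) m \<in> W - {v}" using M'W a(1) NW lM(3) by auto
        qed (use M'L lM Msub in auto)
        then have "stress_free (p(v := p a + q l)) q lv E M"
          using a(1) deg3 unfolding E'_def M'_def N_def K_def
          by (intro stress_free_1_extension_loop[OF fin(1) EV fin(2) Msub gp] lM)
        then show ?thesis using stress_free_generic[OF fin EV Msub MV gen] by blast
      next
        case True
        then have MM: "M' = M" by (auto simp: K_def M'_def)
        have "card N = 3" using deg3 True by simp
        then obtain a b c where abc: "N = {a, b, c}" "a \<noteq> b" "a \<noteq> c" "b \<noteq> c"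
          by (auto simp: card_3_iff)
        have "\<not> tight lv E' M' T" if "N \<subseteq> T" for T
          using tight_not_superset_nbrs[OF s, of v T] that deg3 True
          unfolding tight_def E'_def M'_def N_def K_def by simp
        then have "\<not> (\<exists>T. tight lv E' M' T \<and> {a, b, c} \<subseteq> T)" using abc(1) by blast
        \<comment> \<open>If all three pairs of neighbours were blocked, \<open>tight_three\<close>
          would give a tight set containing \<open>a\<close>, \<open>b\<close> and
          \<open>c\<close>.\<close>
        then obtain x y z where xyz: "N = {x, y, z}" "x \<noteq> y" "x \<noteq> z" "y \<noteq> z"
          and no: "\<And>T. tight lv E' M' T \<Longrightarrow> \<not> {x, y} \<subseteq> T"
        proof -
          assume A: "\<not> (\<exists>T. tight lv E' M' T \<and> {a, b, c} \<subseteq> T)"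
          consider "\<And>T. tight lv E' M' T \<Longrightarrow> \<not> {a, b} \<subseteq> T"
            | "\<And>T. tight lv E' M' T \<Longrightarrow> \<not> {a, c} \<subseteq> T"
            | "\<And>T. tight lv E' M' T \<Longrightarrow> \<not> {b, c} \<subseteq> T"
          proof -
            have "False" if "tight lv E' M' P" "{a, b} \<subseteq> P" "tight lv E' M' Q" "{a, c} \<subseteq> Q"
              "tight lv E' M' R" "{b, c} \<subseteq> R" for P Q R
              using tight_three[OF s' that(1,3,5), of a b c] that abc A by blast
            then show thesis using that by blast
          qed
          then show thesis
          proof cases
            case 1 then show thesis using that[of a b c] abc by blast
          next
            case 2 then show thesis using that[of a c b] abc by blast
          next
            case 3 then show thesis using that[of b c a] abc by blast
          qed
        qed
        have new: "{x, y} \<notin> E'" and "sparse lv (insert {x, y} E') M"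
          using sparse_insert_edge[OF s' xyz(2) no] by (auto simp: MM)
        moreover have "\<forall>e\<in>insert {x, y} E'. e \<subseteq> W - {v}" using E'W NW xyz(1) by blast
        ultimately have "stress_free p q lv (insert {x, y} E') M"
          using IH Msub M'W unfolding MM by blast
        moreover have "{x, y} \<notin> E" using new NW xyz(1) by (auto simp: E'_def)
        moreover have "\<forall>l\<in>M. lv l \<noteq> v" using True by (auto simp: K_def)
        ultimately have "stress_free (p(v := (1/2) *\<^sub>R (p x + p y))) q lv E M"
          using xyz unfolding E'_def N_def
          by (intro stress_free_1_extension_edge[OF fin(1) EV gp])
        then show ?thesis using stress_free_generic[OF fin EV Msub MV gen] by blast
      qed
    qed
  qed
qed

section \<open>Counting in weakly balanced graphs\<close>

text \<open>Edges leave \<open>S\<close> only into \<open>T\<close>, so the component of G - T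
  through a vertex of \<open>S\<close> stays inside \<open>S\<close>. In this form balance is used
  without mentioning components.\<close>

lemma weakly_balanced_cut:
  fixes G :: "('v, 'l) lgraph"
  assumes G: "looped_simple_graph G" and bal: "weakly_balanced k G"
    and S: "S \<subseteq> verts G" "S \<noteq> {}" and T: "T \<subseteq> verts G" "S \<inter> T = {}"
    and cut: "\<And>e. e \<in> edges G \<Longrightarrow> e \<inter> S \<noteq> {} \<Longrightarrow> e \<subseteq> S \<union> T"
  shows "k \<le> card T + card (loops_at (loop_vertex G) (loops G) S)"
proof (cases "card T \<le> k")
  case True
  let ?H = "delete_verts G T"
  obtain z where z: "z \<in> S" using S(2) by blast
  define C where "C = connected_rel ?H `` {z}"
  have "z \<in> verts ?H" using z S(1) T(2) by (auto simp: delete_verts_def)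
  then have "C \<in> components ?H" unfolding C_def components_def by (rule quotientI)
  then have "k - card T \<le> card {l \<in> loops ?H. loop_vertex G l \<in> C}"
    using bal T(1) True unfolding weakly_balanced_def by blast
  moreover have "C \<subseteq> S"
  proof
    fix w assume "w \<in> C"
    then have "(z, w) \<in> {(x, y). {x, y} \<in> edges ?H}\<^sup>*" by (simp add: C_def connected_rel_def)
    then show "w \<in> S"
    proof (induction rule: rtrancl_induct)
      case base
      show ?case by (rule z)
    next
      case (step x y)
      then have e: "{x, y} \<in> edges G" "{x, y} \<inter> T = {}" by (auto simp: delete_verts_def)
      then have "{x, y} \<subseteq> S \<union> T" using cut[of "{x, y}"] step.IH by blast
      then show ?case using e(2) by blast
    qed
  qed
  then have "card {l \<in> loops ?H. loop_vertex G l \<in> C} \<le> card (loops_at (loop_vertex G) (loops G) S)"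
    using looped_simple_graph.finite_loops[OF G]
    by (intro card_mono) (auto simp: delete_verts_def loops_at_def)
  ultimately show ?thesis by linarith
qed simp

text \<open>What a vertex pays to each set of size \<open>s\<close> containing it in the discharging argument below.\<close>

definition charge :: "nat \<Rightarrow> int" where
  "charge s = (if s \<le> 2 then 3 else if s \<le> 5 then 2 else 1)"

text \<open>Here \<open>A\<close> are the sets at the vertex and \<open>m\<close> its loops. Four or
  more sets are harmless, as 3n \<le> 4n - 4. With fewer, the degree bound forces loops or large
  sets, which are charged less: two sets and no loop have at least the sizes (2,6), (3,5) or (4,4),
  with total charge 4. A single set and no loop leaves a budget of 0, which is why bad vertices are
  exempt.\<close>

lemma charge_vertex:
  assumes A: "finite A" "\<forall>X\<in>A. 2 \<le> s X" and deg: "6 \<le> (\<Sum>X\<in>A. s X - 1) + (m :: nat)"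
    and good: "\<not> (card A = 1 \<and> m = 0)"
  shows "(\<Sum>X\<in>A. charge (s X)) \<le> 4 * int (card A) - 4 + int m"
proof -
  consider "card A = 0" | "card A = 1" | "card A = 2" | "card A = 3" | "4 \<le> card A" by linarith
  then show ?thesis
  proof cases
    case 1
    then show ?thesis using A(1) deg by simp
  next
    case 2
    then obtain X where X: "A = {X}" by (auto simp: card_1_singleton_iff)
    show ?thesis using A(2) deg good unfolding X by (auto simp: charge_def)
  next
    case 3
    then obtain X Y where X: "A = {X, Y}" "X \<noteq> Y" by (auto simp: card_2_iff)
    show ?thesis using A(2) deg X(2) unfolding X(1) by (auto simp: charge_def)
  next
    case 4
    then obtain X Y Z where X: "A = {X, Y, Z}" "X \<noteq> Y" "X \<noteq> Z" "Y \<noteq> Z" by (auto simp: card_3_iff)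
    show ?thesis using A(2) deg X(2-4) unfolding X(1) by (auto simp: charge_def)
  next
    case 5
    have "(\<Sum>X\<in>A. charge (s X)) \<le> (\<Sum>X\<in>A. 3)" by (intro sum_mono) (simp add: charge_def)
    then show ?thesis using 5 by simp
  qed
qed

text \<open>For \<open>s\<close> at least 2, \<open>charge s\<close> is the least integer not below
  6/s, so \<open>s\<close> paying vertices raise 6. If one vertex of the set is in \<open>Y\<close>,
  the others must raise only 3; if two are, nothing is required.\<close>

lemma charge_set:
  assumes "2 \<le> s" "y \<le> s"
  shows "6 - 3 * int y \<le> int (s - y) * charge s"
proof -
  consider "y = 0" | "y = 1" | "2 \<le> y" by linarith
  then show ?thesis
    using assms by cases (auto simp: charge_def)
qed

text \<open>Call \<open>z\<close> bad if it carries no loop and lies in a single set of the family. A good vertex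
  pays to every set containing it; the bad vertices of a set are separated from the rest of the
  graph by its other vertices, so by balance a set with a bad vertex has enough of these. The
  additional 3 comes from the cut between \<open>Y\<close> and its complement.\<close>

lemma weakly_balanced_cover:
  fixes G :: "('v, 'l) lgraph" and Y :: "'v set"
  defines "Z \<equiv> verts G - Y"
  assumes G: "looped_simple_graph G" and bal: "weakly_balanced 6 G"
    and Y: "Y \<subseteq> verts G" "Z \<noteq> {}"
    and fin: "finite \<X>" and X: "\<And>X. X \<in> \<X> \<Longrightarrow> X \<subseteq> verts G \<and> 2 \<le> card X"
    and cover: "\<And>e. e \<in> edges G \<Longrightarrow> \<not> e \<subseteq> Y \<Longrightarrow> \<exists>X\<in>\<X>. e \<subseteq> X"
  shows "2 * int (card Z) + 3 \<le>
    (\<Sum>X\<in>\<X>. 2 * int (card X) - 3) + int (card (loops_at (loop_vertex G) (loops G) Z))"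
proof -
  note finV = looped_simple_graph.finite_verts[OF G] and finL = looped_simple_graph.finite_loops[OF G]
    and simple = looped_simple_graph.edges_simple[OF G]
  define fam where "fam z = {X \<in> \<X>. z \<in> X}" for z
  define lp where "lp z = card {l \<in> loops G. loop_vertex G l = z}" for z
  define good where "good z \<longleftrightarrow> \<not> (card (fam z) = 1 \<and> lp z = 0)" for z
  let ?L = "loops_at (loop_vertex G) (loops G) Z"
  have finX: "finite X" if "X \<in> \<X>" for X using X[OF that] finV finite_subset by blast
  have finZ: "finite Z" using finV by (simp add: Z_def)
  have fin_fam: "finite (fam z)" for z using fin by (simp add: fam_def)
  have card_X: "card X = card (X \<inter> Z) + card (X \<inter> Y)" if "X \<in> \<X>" for X
  proof -
    have "X = (X \<inter> Z) \<union> (X \<inter> Y)" using X[OF that] by (auto simp: Z_def)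
    moreover have "card ((X \<inter> Z) \<union> (X \<inter> Y)) = card (X \<inter> Z) + card (X \<inter> Y)"
      using finX[OF that] by (intro card_Un_disjoint) (auto simp: Z_def)
    ultimately show ?thesis by simp
  qed
  \<comment> \<open>Balance applied to all of \<open>Z\<close>: its neighbours in \<open>Y\<close>
    are each counted in some \<open>X \<inter> Y\<close>.\<close>
  have boundary: "6 \<le> (\<Sum>X\<in>\<X>. card (X \<inter> Y)) + card ?L"
  proof -
    define T where "T = {y \<in> Y. \<exists>e\<in>edges G. y \<in> e \<and> e \<inter> Z \<noteq> {}}"
    have "6 \<le> card T + card ?L"
    proof (rule weakly_balanced_cut[OF G bal])
      show "e \<subseteq> Z \<union> T" if "e \<in> edges G" "e \<inter> Z \<noteq> {}" for e
        using that simple[OF that(1)] unfolding T_def Z_def by blast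
    qed (use Y in \<open>auto simp: T_def Z_def\<close>)
    moreover have "card T \<le> card (\<Union>X\<in>\<X>. X \<inter> Y)"
    proof (rule card_mono)
      show "finite (\<Union>X\<in>\<X>. X \<inter> Y)" using fin finX by blast
      show "T \<subseteq> (\<Union>X\<in>\<X>. X \<inter> Y)"
      proof
        fix y assume "y \<in> T"
        then obtain e where e: "y \<in> Y" "e \<in> edges G" "y \<in> e" "\<not> e \<subseteq> Y"
          unfolding T_def Z_def by blast
        then show "y \<in> (\<Union>X\<in>\<X>. X \<inter> Y)" using cover[OF e(2,4)] by blast
      qed
    qed
    ultimately show ?thesis using card_UN_le[OF fin, of "\<lambda>X. X \<inter> Y"] by linarith
  qed
  \<comment> \<open>Balance applied to the single vertex \<open>z\<close>, whose neighbours are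
    covered by the sets through \<open>z\<close>.\<close>
  have degree: "6 \<le> (\<Sum>X\<in>fam z. card X - 1) + lp z" if z: "z \<in> Z" for z
  proof -
    have "card (loops_at (loop_vertex G) (loops G) {z}) = lp z"
      by (simp add: loops_at_def lp_def)
    moreover have "6 \<le> card (nbrs (edges G) z) + card (loops_at (loop_vertex G) (loops G) {z})"
    proof (rule weakly_balanced_cut[OF G bal])
      show "nbrs (edges G) z \<subseteq> verts G" using simple by (auto simp: nbrs_def)
      show "{z} \<inter> nbrs (edges G) z = {}" using self_notin_nbrs[of "edges G" z] simple by blast
      show "e \<subseteq> {z} \<union> nbrs (edges G) z" if "e \<in> edges G" "e \<inter> {z} \<noteq> {}" for e
      proof -
        have "e \<in> (\<lambda>u. {u, z}) ` nbrs (edges G) z"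
          using bij_betw_imp_surj_on[OF bij_betw_nbrs, of "edges G" z] simple that by blast
        then show ?thesis by blast
      qed
    qed (use z in \<open>auto simp: Z_def\<close>)
    moreover have "card (nbrs (edges G) z) \<le> card (\<Union>X\<in>fam z. X - {z})"
    proof (rule card_mono)
      show "finite (\<Union>X\<in>fam z. X - {z})" using fin_fam finX by (auto simp: fam_def)
      show "nbrs (edges G) z \<subseteq> (\<Union>X\<in>fam z. X - {z})"
      proof
        fix u assume "u \<in> nbrs (edges G) z"
        then have e: "{u, z} \<in> edges G" by (simp add: nbrs_def)
        then have "u \<noteq> z" using simple[OF e] by auto
        moreover obtain X where "X \<in> \<X>" "{u, z} \<subseteq> X" using cover[OF e] z by (auto simp: Z_def)
        ultimately show "u \<in> (\<Union>X\<in>fam z. X - {z})" by (auto simp: fam_def)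
      qed
    qed
    moreover have "card (\<Union>X\<in>fam z. X - {z}) \<le> (\<Sum>X\<in>fam z. card (X - {z}))"
      by (rule card_UN_le[OF fin_fam])
    moreover have "(\<Sum>X\<in>fam z. card (X - {z})) = (\<Sum>X\<in>fam z. card X - 1)"
      by (intro sum.cong) (auto simp: fam_def)
    ultimately show ?thesis by linarith
  qed
  have vertex: "(\<Sum>X\<in>fam z. if good z then charge (card X) else 0) \<le> 4 * int (card (fam z)) - 4 + int (lp z)"
    if z: "z \<in> Z" for z
  proof (cases "good z")
    case True
    then show ?thesis
      using charge_vertex[OF fin_fam _ degree[OF z]] X by (simp add: good_def fam_def)
  next
    case False
    then show ?thesis by (simp add: good_def)
  qed
  have set: "6 - 3 * int (card (X \<inter> Y)) \<le> (\<Sum>z\<in>X \<inter> Z. if good z then charge (card X) else 0)"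
    if XX: "X \<in> \<X>" for X
  proof -
    define B where "B = {z \<in> X \<inter> Z. \<not> good z}"
    define D where "D = {z \<in> X \<inter> Z. good z}"
    have finXZ: "finite (X \<inter> Z)" using finX[OF XX] by simp
    have sum: "(\<Sum>z\<in>X \<inter> Z. if good z then charge (card X) else 0) = int (card D) * charge (card X)"
      using finXZ by (simp add: D_def sum.If_cases Int_def)
    show ?thesis
    proof (cases "B = {}")
      case True
      then have "D = X \<inter> Z" by (auto simp: B_def D_def)
      then have "card D = card X - card (X \<inter> Y)" using card_X[OF XX] by simp
      then show ?thesis
        unfolding sum using charge_set[of "card X" "card (X \<inter> Y)"] X[OF XX] card_X[OF XX] by simp
    next
      case False
      \<comment> \<open>A bad vertex lies in no other set, so all its edges stay in
        \<open>X\<close>. Since \<open>B\<close> has no loops, X - B has at least 6 vertices, and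
        those in \<open>Z\<close> are good and pay at least 1 each.\<close>
      have "6 \<le> card (X - B) + card (loops_at (loop_vertex G) (loops G) B)"
      proof (rule weakly_balanced_cut[OF G bal])
        show "e \<subseteq> B \<union> (X - B)" if e: "e \<in> edges G" "e \<inter> B \<noteq> {}" for e
        proof -
          obtain b where b: "b \<in> e" "b \<in> B" using e(2) by blast
          then have "\<not> e \<subseteq> Y" by (auto simp: B_def Z_def)
          then obtain X' where X': "X' \<in> \<X>" "e \<subseteq> X'" using cover[OF e(1)] by blast
          have "card (fam b) = 1" using b(2) by (simp add: B_def good_def)
          moreover have "X \<in> fam b" "X' \<in> fam b" using b XX X' by (auto simp: B_def fam_def)
          ultimately have "X' = X" by (auto simp: card_1_singleton_iff)
          then show ?thesis using X'(2) by blast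
        qed
      qed (use X[OF XX] False in \<open>auto simp: B_def\<close>)
      moreover have "loops_at (loop_vertex G) (loops G) B = {}"
      proof -
        have "{l \<in> loops G. loop_vertex G l = b} = {}" if "b \<in> B" for b
          using that finL by (simp add: B_def good_def lp_def)
        then show ?thesis by (auto simp: loops_at_def)
      qed
      moreover have "X - B = D \<union> (X \<inter> Y)" using X[OF XX] by (auto simp: B_def D_def Z_def)
      then have "card (X - B) \<le> card D + card (X \<inter> Y)" by (simp add: card_Un_le)
      ultimately have "6 \<le> int (card D) + int (card (X \<inter> Y))" by simp
      moreover have "int (card D) * 1 \<le> int (card D) * charge (card X)"
        by (intro mult_left_mono) (auto simp: charge_def)
      ultimately show ?thesis unfolding sum by linarith
    qed
  qed
  have "(\<Sum>X\<in>\<X>. 6 - 3 * int (card (X \<inter> Y))) \<le>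
      (\<Sum>X\<in>\<X>. \<Sum>z\<in>X \<inter> Z. if good z then charge (card X) else 0)"
    by (intro sum_mono set)
  also have "\<dots> = (\<Sum>X\<in>\<X>. \<Sum>z\<in>{z \<in> Z. z \<in> X}. if good z then charge (card X) else 0)"
    by (intro sum.cong) auto
  also have "\<dots> = (\<Sum>z\<in>Z. \<Sum>X\<in>fam z. if good z then charge (card X) else 0)"
    unfolding fam_def by (rule sum.swap_restrict[OF fin finZ])
  also have "\<dots> \<le> (\<Sum>z\<in>Z. 4 * int (card (fam z)) - 4 + int (lp z))"
    by (intro sum_mono vertex)
  also have "\<dots> = 4 * (\<Sum>X\<in>\<X>. int (card (X \<inter> Z))) - 4 * int (card Z) + int (card ?L)"
  proof -
    have "(\<Sum>z\<in>Z. card (fam z)) = (\<Sum>X\<in>\<X>. card (X \<inter> Z))"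
      unfolding fam_def by (rule sum_multicount_gen[OF finZ fin]) (auto intro!: arg_cong[where f = card])
    moreover have "(\<Sum>z\<in>Z. lp z) = card ?L"
    proof -
      have "(\<Sum>z\<in>Z. card {l \<in> ?L. loop_vertex G l = z}) = 1 * card ?L"
      proof (rule sum_multicount[OF finZ], use finL in simp, intro ballI)
        fix l assume "l \<in> ?L"
        then have "{z \<in> Z. loop_vertex G l = z} = {loop_vertex G l}" by (auto simp: loops_at_def)
        then show "card {z \<in> Z. loop_vertex G l = z} = 1" by simp
      qed
      moreover have "{l \<in> ?L. loop_vertex G l = z} = {l \<in> loops G. loop_vertex G l = z}" if "z \<in> Z" for z
        using that by (auto simp: loops_at_def)
      ultimately show ?thesis by (simp add: lp_def)
    qed
    ultimately show ?thesis
      by (simp add: sum.distrib sum_subtractf flip: sum_distrib_left of_nat_sum)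
  qed
  finally have "6 * int (card \<X>) - 3 * (\<Sum>X\<in>\<X>. int (card (X \<inter> Y))) \<le>
      4 * (\<Sum>X\<in>\<X>. int (card (X \<inter> Z))) - 4 * int (card Z) + int (card ?L)"
    by (simp add: sum_subtractf sum_distrib_left)
  moreover have "(\<Sum>X\<in>\<X>. 2 * int (card X) - 3) =
      2 * (\<Sum>X\<in>\<X>. int (card (X \<inter> Z))) + 2 * (\<Sum>X\<in>\<X>. int (card (X \<inter> Y))) - 3 * int (card \<X>)"
    by (simp add: card_X sum_subtractf sum_distrib_left sum.distrib)
  moreover have "6 \<le> (\<Sum>X\<in>\<X>. int (card (X \<inter> Y))) + int (card ?L)"
    using boundary by (simp flip: of_nat_sum)
  ultimately show ?thesis by linarith
qed

section \<open>Maximal sparse sets\<close>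

text \<open>Cutting \<open>T\<close> down to \<open>W\<close> loses no edge or loop, so the bounds
  for \<open>T \<inter> W\<close> leave no room for it to be smaller.\<close>

lemma tight_subset:
  assumes s: "sparse lv E M" and W: "\<forall>e\<in>E. e \<subseteq> W" "\<forall>l\<in>M. lv l \<in> W" and T: "tight lv E M T"
  shows "T \<subseteq> W"
proof -
  have fin: "finite T" using tight_finite[OF T] .
  have "induced E (T \<inter> W) = induced E T" "loops_at lv M (T \<inter> W) = loops_at lv M T"
    using W by (auto simp: induced_def loops_at_def)
  then have le: "card (induced E T) + card (loops_at lv M T) \<le> 2 * card (T \<inter> W)"
    "2 \<le> card (T \<inter> W) \<Longrightarrow> card (induced E T) + 3 \<le> 2 * card (T \<inter> W)"
    using sparseD(4,5)[OF s, of "T \<inter> W"] fin by auto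
  have "card T \<le> card (T \<inter> W)"
  proof (cases "full_tight lv E M T")
    case True
    then show ?thesis using le(1) by (simp add: full_tight_def)
  next
    case False
    then have e: "card (induced E T) + 3 = 2 * card T" "2 \<le> card T"
      using T by (auto simp: tight_def edge_tight_def)
    \<comment> \<open>The number 2|T| - 3 is odd. An edge inside \<open>T\<close> then guarantees
      two vertices in \<open>T \<inter> W\<close>, as the edge bound there demands.\<close>
    then have "card (induced E T) \<noteq> 0" by presburger
    then have "induced E T \<noteq> {}" by auto
    then obtain e where "e \<in> E" "e \<subseteq> T" by (auto simp: induced_def)
    then have "card e \<le> card (T \<inter> W)" "card e = 2"
      using W fin card_mono[of "T \<inter> W" e] sparseD(3)[OF s] by auto
    then show ?thesis using e le(2) by simp
  qed
  then have "T \<inter> W = T" using fin by (intro card_seteq) auto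
  then show ?thesis by blast
qed

lemma edge_tight_edge:
  assumes s: "sparse lv E L" and e: "e \<in> E"
  shows "edge_tight E e"
proof -
  have "card e = 2" using sparseD(3)[OF s] e by blast
  moreover have "finite e" using \<open>card e = 2\<close> card.infinite by fastforce
  moreover have "card {e} \<le> card (induced E e)"
    using e sparseD(1)[OF s] by (intro card_mono) (auto simp: induced_def)
  ultimately show ?thesis using sparseD(5)[OF s, of e] by (simp add: edge_tight_def)
qed

lemma maximal_sparse_exists:
  assumes "finite E0" "finite L0"
  obtains E M where "E \<subseteq> E0" "M \<subseteq> L0" "sparse lv E M"
    "\<forall>E' M'. E \<subseteq> E' \<and> E' \<subseteq> E0 \<and> M \<subseteq> M' \<and> M' \<subseteq> L0 \<and> sparse lv E' M' \<longrightarrow> E' = E \<and> M' = M"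
proof -
  define S where "S = {(E, M). E \<subseteq> E0 \<and> M \<subseteq> L0 \<and> sparse lv E M}"
  let ?f = "\<lambda>Q. card (fst Q) + card (snd Q)"
  have fin: "finite S" by (rule finite_subset[of _ "Pow E0 \<times> Pow L0"]) (use assms in \<open>auto simp: S_def\<close>)
  have "({}, {}) \<in> S" by (auto simp: S_def sparse_def induced_def loops_at_def)
  then have "Max (?f ` S) \<in> ?f ` S" using fin by (intro Max_in) auto
  then obtain P where P: "P \<in> S" "?f P = Max (?f ` S)" by auto
  have max: "?f Q \<le> ?f P" if "Q \<in> S" for Q
    unfolding P(2) using that fin by (intro Max_ge) auto
  obtain E M where EM: "P = (E, M)" by (cases P)
  show thesis
  proof (rule that)
    show "E \<subseteq> E0" "M \<subseteq> L0" "sparse lv E M" using P(1) by (auto simp: EM S_def)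
    show "\<forall>E' M'. E \<subseteq> E' \<and> E' \<subseteq> E0 \<and> M \<subseteq> M' \<and> M' \<subseteq> L0 \<and> sparse lv E' M' \<longrightarrow> E' = E \<and> M' = M"
    proof (intro allI impI, elim conjE)
      fix E' M' assume *: "E \<subseteq> E'" "E' \<subseteq> E0" "M \<subseteq> M'" "M' \<subseteq> L0" "sparse lv E' M'"
      then have fin: "finite E'" "finite M'" using sparseD by blast+
      have "card E' + card M' \<le> card E + card M" using max[of "(E', M')"] * by (simp add: EM S_def)
      moreover have "card E \<le> card E'" "card M \<le> card M'" using card_mono fin * by blast+
      ultimately show "E' = E \<and> M' = M" using card_seteq[OF fin(1) *(1)] card_seteq[OF fin(2) *(3)] by simp
    qed
  qed
qed

text \<open>A maximal sparse subgraph is described by its tight sets: the largest fully tight set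
  \<open>Y\<close> and the maximal edge-tight sets not inside \<open>Y\<close>, any two of which share at most one vertex.\<close>

lemma maximal_sparse_structure:
  assumes W: "finite W" and E0: "\<forall>e\<in>E0. e \<subseteq> W \<and> card e = 2"
    and L0: "finite L0" "\<forall>l\<in>L0. lv l \<in> W"
  obtains E M Y \<X> where "E \<subseteq> E0" "M \<subseteq> L0" "sparse lv E M" "Y \<subseteq> W"
    "finite \<X>" "\<forall>X\<in>\<X>. X \<subseteq> W \<and> 2 \<le> card X"
    "\<forall>e\<in>E0. \<not> e \<subseteq> Y \<longrightarrow> (\<exists>X\<in>\<X>. e \<subseteq> X)"
    "2 * int (card Y) + (\<Sum>X\<in>\<X>. 2 * int (card X) - 3) + int (card (loops_at lv L0 (W - Y)))
       \<le> int (card E + card M)"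
proof -
  have "E0 \<subseteq> Pow W" using E0 by blast
  then have finE0: "finite E0" using W finite_subset by blast
  obtain E M where EM: "E \<subseteq> E0" "M \<subseteq> L0" and s: "sparse lv E M"
    and max: "\<forall>E' M'. E \<subseteq> E' \<and> E' \<subseteq> E0 \<and> M \<subseteq> M' \<and> M' \<subseteq> L0 \<and> sparse lv E' M' \<longrightarrow> E' = E \<and> M' = M"
    using maximal_sparse_exists[OF finE0 L0(1), of lv] .
  have finE: "finite E" and finM: "finite M" using sparseD[OF s] by auto
  have sub: "T \<subseteq> W" if "tight lv E M T" for T
    by (rule tight_subset[OF s _ _ that]) (use EM E0 L0 in blast)+
  have fin_tight: "finite {T. tight lv E M T}"
    by (rule finite_subset[of _ "Pow W"]) (use sub W in auto)
  define Y where "Y = \<Union>{T. full_tight lv E M T}"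
  have "finite {T. full_tight lv E M T}"
    by (rule finite_subset[OF _ fin_tight]) (auto simp: tight_def)
  then have Y: "full_tight lv E M Y" unfolding Y_def by (intro full_tight_Union[OF s]) auto
  have in_Y: "T \<subseteq> Y" if "full_tight lv E M T" for T using that by (auto simp: Y_def)
  define \<X> where "\<X> = {X. edge_tight E X \<and> \<not> X \<subseteq> Y \<and> (\<forall>X'. edge_tight E X' \<and> X \<subseteq> X' \<longrightarrow> X' = X)}"
  have X: "edge_tight E X" "\<not> X \<subseteq> Y" if "X \<in> \<X>" for X using that by (auto simp: \<X>_def)
  have finX: "finite \<X>" by (rule finite_subset[OF _ fin_tight]) (use X in \<open>auto simp: tight_def\<close>)
  have in_X: "\<exists>X\<in>\<X>. T \<subseteq> X" if T: "edge_tight E T" "\<not> T \<subseteq> Y" for T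
  proof -
    have "finite {T. edge_tight E T}" by (rule finite_subset[OF _ fin_tight]) (auto simp: tight_def)
    then obtain X where "edge_tight E X" "T \<subseteq> X" "\<forall>X'\<in>{T. edge_tight E T}. X \<subseteq> X' \<longrightarrow> X = X'"
      using finite_has_maximal2[of "{T. edge_tight E T}" T] T(1) by blast
    then show ?thesis using T(2) by (intro bexI[of _ X]) (auto simp: \<X>_def)
  qed
  have cover: "\<exists>X\<in>\<X>. e \<subseteq> X" if e: "e \<in> E0" "\<not> e \<subseteq> Y" for e
  proof (cases "e \<in> E")
    case True
    then show ?thesis using in_X edge_tight_edge[OF s] e(2) by blast
  next
    case False
    obtain a b where ab: "e = {a, b}" "a \<noteq> b" using E0 e(1) by (meson card_2_iff)
    have "\<not> sparse lv (insert e E) M" using max[rule_format, of "insert e E" M] False e(1) EM by blast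
    then obtain T where T: "tight lv E M T" "e \<subseteq> T" using sparse_insert_edge(2)[OF s ab(2)] ab(1) by blast
    have "\<not> T \<subseteq> Y" using T(2) e(2) by blast
    \<comment> \<open>A fully tight set would be contained in \<open>Y\<close>.\<close>
    moreover have "edge_tight E T" using T(1) in_Y[of T] \<open>\<not> T \<subseteq> Y\<close> unfolding tight_def by blast
    ultimately obtain X where "X \<in> \<X>" "T \<subseteq> X" using in_X[of T] by blast
    then show ?thesis using T(2) by (meson subset_trans)
  qed
  have loops: "loops_at lv L0 (W - Y) = loops_at lv M (W - Y)"
  proof -
    have "l \<in> M" if l: "l \<in> L0" "lv l \<notin> Y" for l
    proof (rule ccontr)
      assume "l \<notin> M"
      \<comment> \<open>No fully tight set contains the vertex of \<open>l\<close>, so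
        \<open>l\<close> could be inserted where it sits, against maximality.\<close>
      then have "sparse (lv(l := lv l)) E (insert l M)" using in_Y l(2) by (intro sparse_insert_loop[OF s]) auto
      then show False using max[rule_format, of E "insert l M"] \<open>l \<notin> M\<close> l(1) EM by auto
    qed
    then show ?thesis using EM(2) by (auto simp: loops_at_def)
  qed
  have no_edge: "induced E A \<inter> induced E B = {}" if "\<not> 2 \<le> card (A \<inter> B)" "finite A" for A B
  proof (rule ccontr)
    assume "\<not> ?thesis"
    then obtain e where "e \<in> E" "e \<subseteq> A \<inter> B" by (auto simp: induced_def)
    then have "card e = 2" "card e \<le> card (A \<inter> B)"
      using sparseD(3)[OF s] that(2) card_mono[of "A \<inter> B" e] by auto
    then show False using that(1) by simp
  qed
  \<comment> \<open>With two common vertices, \<open>Y \<union> X\<close> would be fully tight and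
    \<open>X\<close> would be swallowed by \<open>Y\<close>.\<close>
  have XY: "induced E Y \<inter> induced E X = {}" if "X \<in> \<X>" for X
  proof (rule no_edge)
    show "\<not> 2 \<le> card (Y \<inter> X)"
      using full_tight_Un_edge_tight[OF s Y X(1)[OF that]] in_Y X(2)[OF that] by blast
    show "finite Y" using Y by (simp add: full_tight_def)
  qed
  have XX: "induced E X \<inter> induced E X' = {}" if "X \<in> \<X>" "X' \<in> \<X>" "X \<noteq> X'" for X X'
  proof (rule no_edge)
    show "\<not> 2 \<le> card (X \<inter> X')"
    proof
      assume "2 \<le> card (X \<inter> X')"
      then have "edge_tight E (X \<union> X')" using edge_tight_Un[OF s] X that by blast
      then have "X \<union> X' = X" "X \<union> X' = X'" using that by (auto simp: \<X>_def)
      then show False using that(3) by blast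
    qed
    show "finite X" using X(1)[OF that(1)] by (simp add: edge_tight_def)
  qed
  have "card (induced E Y) + (\<Sum>X\<in>\<X>. card (induced E X)) = card (induced E Y \<union> (\<Union>X\<in>\<X>. induced E X))"
  proof -
    have "card (\<Union>X\<in>\<X>. induced E X) = (\<Sum>X\<in>\<X>. card (induced E X))"
      using finX finE XX by (intro card_UN_disjoint) auto
    moreover have "card (induced E Y \<union> (\<Union>X\<in>\<X>. induced E X)) = card (induced E Y) + card (\<Union>X\<in>\<X>. induced E X)"
      using finX finE XY by (intro card_Un_disjoint) auto
    ultimately show ?thesis by simp
  qed
  also have "\<dots> \<le> card E" using finE by (intro card_mono) (auto simp: induced_def)
  finally have cE: "int (card (induced E Y)) + (\<Sum>X\<in>\<X>. int (card (induced E X))) \<le> int (card E)"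
    by (simp flip: of_nat_sum of_nat_add)
  have tight_X: "(\<Sum>X\<in>\<X>. int (card (induced E X))) = (\<Sum>X\<in>\<X>. 2 * int (card X) - 3)"
  proof (intro sum.cong refl)
    fix X assume "X \<in> \<X>"
    then show "int (card (induced E X)) = 2 * int (card X) - 3"
      using X(1) unfolding edge_tight_def by fastforce
  qed
  have "card M = card (loops_at lv M Y \<union> loops_at lv M (W - Y))"
    using EM(2) L0(2) by (intro arg_cong[where f = card]) (auto simp: loops_at_def)
  also have "\<dots> = card (loops_at lv M Y) + card (loops_at lv M (W - Y))"
    using finM by (intro card_Un_disjoint) (auto simp: loops_at_def)
  finally have cM: "card M = card (loops_at lv M Y) + card (loops_at lv L0 (W - Y))" unfolding loops .
  show thesis
  proof (rule that[OF EM s _ finX])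
    show "\<forall>e\<in>E0. \<not> e \<subseteq> Y \<longrightarrow> (\<exists>X\<in>\<X>. e \<subseteq> X)" using cover by blast
    show "Y \<subseteq> W" using sub Y by (simp add: tight_def)
    show "\<forall>X\<in>\<X>. X \<subseteq> W \<and> 2 \<le> card X"
    proof
      fix X assume "X \<in> \<X>"
      then show "X \<subseteq> W \<and> 2 \<le> card X"
        using sub[of X] X(1)[of X] by (simp add: tight_def edge_tight_def)
    qed
    show "2 * int (card Y) + (\<Sum>X\<in>\<X>. 2 * int (card X) - 3) + int (card (loops_at lv L0 (W - Y)))
       \<le> int (card E + card M)"
      using cE cM Y unfolding tight_X full_tight_def by linarith
  qed
qed

text \<open>Balance is known for \<open>G\<close> only, so the cover has to reach the deleted edges
  and count the deleted loops too. That costs at most 3, which the bound of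
  \<open>weakly_balanced_cover\<close> allows for.\<close>

lemma weakly_balanced_sparse_subgraph:
  fixes G :: "('v, 'l) lgraph" and F :: "('v set + 'l) set"
  defines "E0 \<equiv> {e \<in> edges G. Inl e \<notin> F}" and "L0 \<equiv> {l \<in> loops G. Inr l \<notin> F}"
  assumes G: "looped_simple_graph G" and bal: "weakly_balanced 6 G"
    and F: "F \<subseteq> elements G" "card F \<le> 3"
  obtains E M where "E \<subseteq> E0" "M \<subseteq> L0" "sparse (loop_vertex G) E M" "2 * card (verts G) \<le> card E + card M"
proof -
  let ?lv = "loop_vertex G" and ?V = "verts G"
  note finV = looped_simple_graph.finite_verts[OF G] and finL = looped_simple_graph.finite_loops[OF G]
    and simple = looped_simple_graph.edges_simple[OF G]
  have finE: "finite (edges G)"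
    by (rule finite_subset[of _ "Pow ?V"]) (use simple finV in auto)
  obtain E M Y \<X> where EM: "E \<subseteq> E0" "M \<subseteq> L0" "sparse ?lv E M" and Y: "Y \<subseteq> ?V"
    and X: "finite \<X>" "\<forall>X\<in>\<X>. X \<subseteq> ?V \<and> 2 \<le> card X"
      "\<forall>e\<in>E0. \<not> e \<subseteq> Y \<longrightarrow> (\<exists>X\<in>\<X>. e \<subseteq> X)"
    and card: "2 * int (card Y) + (\<Sum>X\<in>\<X>. 2 * int (card X) - 3) + int (card (loops_at ?lv L0 (?V - Y)))
       \<le> int (card E + card M)"
  proof (rule maximal_sparse_structure[OF finV, of E0 L0 ?lv])
    show "\<forall>e\<in>E0. e \<subseteq> ?V \<and> card e = 2" using simple by (auto simp: E0_def)
    show "finite L0" "\<forall>l\<in>L0. ?lv l \<in> ?V"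
      using finL looped_simple_graph.loop_vertex_in_verts[OF G] by (auto simp: L0_def)
  qed
  define FE FL where "FE = {e \<in> edges G. Inl e \<in> F}" and "FL = {l \<in> loops G. Inr l \<in> F}"
  have finFE: "finite FE" and finFL: "finite FL" using finE finL by (auto simp: FE_def FL_def)
  have "F = FE <+> FL" using F(1) by (auto simp: FE_def FL_def elements_def)
  then have FF: "card FE + card FL \<le> 3" using F(2) finFE finFL by (simp add: card_Plus)
  have cV: "card ?V = card Y + card (?V - Y)"
    using Y finV card_mono[OF finV Y] by (simp add: card_Diff_subset finite_subset)
  have "2 * int (card ?V) \<le> int (card E + card M)"
  proof (cases "?V - Y = {}")
    case True
    have "(0 :: int) \<le> (\<Sum>X\<in>\<X>. 2 * int (card X) - 3)"
      using X(2) by (intro sum_nonneg) fastforce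
    then show ?thesis using card cV unfolding True by simp
  next
    case False
    have "2 * int (card (?V - Y)) + 3 \<le>
      (\<Sum>X\<in>\<X> \<union> FE. 2 * int (card X) - 3) + int (card (loops_at ?lv (loops G) (?V - Y)))"
    proof (rule weakly_balanced_cover[OF G bal Y False])
      show "finite (\<X> \<union> FE)" using X(1) finFE by simp
      show "X \<subseteq> ?V \<and> 2 \<le> card X" if "X \<in> \<X> \<union> FE" for X
        using that X(2) simple by (auto simp: FE_def)
      show "\<exists>X\<in>\<X> \<union> FE. e \<subseteq> X" if "e \<in> edges G" "\<not> e \<subseteq> Y" for e
        using that X(3) by (cases "e \<in> E0") (auto simp: FE_def E0_def)
    qed
    \<comment> \<open>Each deleted edge weighs 1, and one that is already a member of \<X> adds
      nothing.\<close>
    moreover have "(\<Sum>X\<in>\<X> \<union> FE. 2 * int (card X) - 3) \<le> (\<Sum>X\<in>\<X>. 2 * int (card X) - 3) + int (card FE)"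
    proof -
      have one: "2 * int (card e) - 3 = 1" if "e \<in> FE" for e using that simple by (auto simp: FE_def)
      have "(\<Sum>X\<in>\<X> \<union> FE. 2 * int (card X) - 3) =
          (\<Sum>X\<in>\<X>. 2 * int (card X) - 3) + (\<Sum>X\<in>FE - \<X>. 2 * int (card X) - 3)"
        using sum.union_disjoint[of \<X> "FE - \<X>" "\<lambda>X. 2 * int (card X) - 3"] X(1) finFE by simp
      moreover have "(\<Sum>X\<in>FE - \<X>. 2 * int (card X) - 3) = int (card (FE - \<X>))" by (simp add: one)
      moreover have "card (FE - \<X>) \<le> card FE" using finFE by (intro card_mono) auto
      ultimately show ?thesis by simp
    qed
    moreover have "card (loops_at ?lv (loops G) (?V - Y)) \<le> card (loops_at ?lv L0 (?V - Y)) + card FL"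
    proof -
      have "loops_at ?lv (loops G) (?V - Y) \<subseteq> loops_at ?lv L0 (?V - Y) \<union> FL"
        by (auto simp: loops_at_def L0_def FL_def)
      then have "card (loops_at ?lv (loops G) (?V - Y)) \<le> card (loops_at ?lv L0 (?V - Y) \<union> FL)"
        using finL finFL by (intro card_mono) (auto simp: L0_def)
      then show ?thesis using card_Un_le le_trans by blast
    qed
    ultimately show ?thesis using card cV FF by linarith
  qed
  then have "2 * card ?V \<le> card E + card M" by linarith
  then show thesis by (rule that[OF EM])
qed

section \<open>The rank of G - F\<close>

lemma lc_independent_sparse:
  fixes G :: "('v, 'l) lgraph"
  assumes "finite (verts G)" "\<forall>e\<in>edges G. e \<subseteq> verts G" "\<forall>l\<in>loops G. loop_vertex G l \<in> verts G"
    and EM: "E \<subseteq> edges G" "M \<subseteq> loops G" and s: "sparse (loop_vertex G) E M"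
  shows "lc_independent TYPE(2) G (E <+> M)"
proof -
  have sub: "\<forall>e\<in>E. e \<subseteq> verts G \<and> card e = 2" "\<forall>l\<in>M. loop_vertex G l \<in> verts G"
    using assms sparseD(3)[OF s] by blast+
  have "rows_independent (rigidity_matrix G p q) (verts G \<times> UNIV) (E <+> M)"
    if "generic G p q" for p :: "'v \<Rightarrow> real^2" and q :: "'l \<Rightarrow> real^2"
  proof -
    have "stress_free p q (loop_vertex G) E M"
      by (rule sparse_stress_free[OF _ assms(1) order_refl])
        (use that sub EM s in \<open>auto simp: generic_def\<close>)
    then show ?thesis
      using stress_free_iff_rows_independent[OF sparseD(1,2)[OF s] sub] by blast
  qed
  then show ?thesis using EM unfolding lc_independent_def elements_def by blast
qed

text \<open>Independence speaks about all generic placements, so to bound it by the number of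
  columns one such placement must be shown to exist.\<close>

lemma lc_independent_card_le:
  fixes G :: "('v, 'l) lgraph"
  assumes "finite (verts G)" "finite (loops G)" "finite X" and X: "lc_independent TYPE('d::finite) G X"
  shows "card X \<le> CARD('d) * card (verts G)"
proof -
  obtain p :: "'v \<Rightarrow> real^'d" and q :: "'l \<Rightarrow> real^'d" where "generic_on (verts G) (loops G) p q"
    using generic_on_exists[OF assms(1,2)] by blast
  then have "rows_independent (rigidity_matrix G p q) (verts G \<times> UNIV) X"
    using X by (auto simp: lc_independent_def generic_def)
  then have "card X \<le> card (verts G \<times> (UNIV :: 'd set))"
    using assms(1) by (intro rows_independent_card_le[OF assms(3)]) auto
  then show ?thesis by (simp add: card_cartesian_product mult.commute)
qed

theorem theorem1p3:
  fixes G :: "('v, 'l) lgraph" and F :: "('v set + 'l) set"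
  assumes "looped_simple_graph G"
    and "weakly_balanced 6 G"
    and "F \<subseteq> elements G" and "card F \<le> 3"
  shows "lc_rigid TYPE(2) (delete_elements G F)"
proof -
  let ?H = "delete_elements G F"
  note finV = looped_simple_graph.finite_verts[OF assms(1)]
    and finL = looped_simple_graph.finite_loops[OF assms(1)]
    and simple = looped_simple_graph.edges_simple[OF assms(1)]
  have sel: "verts ?H = verts G" "edges ?H = {e \<in> edges G. Inl e \<notin> F}"
      "loops ?H = {l \<in> loops G. Inr l \<notin> F}" "loop_vertex ?H = loop_vertex G"
    by (simp_all add: delete_elements_def)
  have "finite (edges G)" by (rule finite_subset[of _ "Pow (verts G)"]) (use simple finV in auto)
  then have fin: "finite (elements ?H)" using finL by (simp add: elements_def sel)
  have upper: "card X \<le> 2 * card (verts G)" if "X \<subseteq> elements ?H" "lc_independent TYPE(2) ?H X" for X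
    using lc_independent_card_le[OF _ _ finite_subset[OF that(1) fin] that(2)] finV finL by (simp add: sel)
  obtain E M where EM: "E \<subseteq> edges ?H" "M \<subseteq> loops ?H" "sparse (loop_vertex ?H) E M"
    and card: "2 * card (verts G) \<le> card E + card M"
    using weakly_balanced_sparse_subgraph[OF assms] unfolding sel by blast
  have ind: "lc_independent TYPE(2) ?H (E <+> M)"
    by (rule lc_independent_sparse[OF _ _ _ EM])
      (use finV simple looped_simple_graph.loop_vertex_in_verts[OF assms(1)] in \<open>auto simp: sel\<close>)
  have sub: "E <+> M \<subseteq> elements ?H" using ind by (simp add: lc_independent_def)
  have "card (E <+> M) = card E + card M"
    using sparseD(1,2)[OF EM(3)] by (simp add: card_Plus)
  then have eq: "card (E <+> M) = 2 * card (verts G)" using card upper[OF sub ind] by simp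
  have "lc_rank TYPE(2) ?H (elements ?H) = 2 * card (verts G)"
    unfolding lc_rank_def
  proof (rule Max_eqI)
    show "finite (card ` {Y. Y \<subseteq> elements ?H \<and> lc_independent TYPE(2) ?H Y})" using fin by simp
    show "n \<le> 2 * card (verts G)" if "n \<in> card ` {Y. Y \<subseteq> elements ?H \<and> lc_independent TYPE(2) ?H Y}" for n
      using that upper by blast
    show "2 * card (verts G) \<in> card ` {Y. Y \<subseteq> elements ?H \<and> lc_independent TYPE(2) ?H Y}"
      using sub ind eq by (intro image_eqI[of _ _ "E <+> M"]) auto
  qed
  then show ?thesis by (simp add: lc_rigid_def sel)
qed

end
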